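(* Let $G$ be a group with finite symmetric generating set $S$ such that $G$ has polynomial volume growth, and let $D$ be its homogeneous dimension. Then there is a constant $C(S)$, depending only on $(G,S)$, such that for every $d\geq 1$, $$\dim H^d(G,S)\leq C(S)\,d^{D-1}.$$
   Context: For a group $G$ with a finite symmetric generating set $S$ ($S=S^{-1}$), the Cayley graph $(G,S)$ has vertex set $G$, and $x\sim y$ iff $x=ys$ for some $s\in S$. The word metric $d^S(x,y)$ is the length of a shortest path in this graph from $x$ to $y$. $B_p(n)=\{x\in G: d^S(x,p)\leq n\}$ and $|B_p(n)|$ is its cardinality; $\beta_S(n)=|B_e(n)|$ with $e$ the identity. $G$ has polynomial volume growth if $\beta_S(n)\leq Cn^{A}$ for some $C,A>0$ and all $n\geq1$. For such $G$ there is an integer $D$ (the homogeneous dimension) and constants $C_1,C_2>0$ with $C_1n^D\leq\beta_S(n)\leq C_2n^D$ for all $n\geq1$. The Laplacian is $L^Su(x)=\sum_{y\sim x}(u(y)-u(x))$, and $u$ is harmonic if $L^Su\equiv0$. For a fixed $p\in G$, $H^d(G,S)=\{u:G\to\mathbb{R}\mid L^Su=0,\ |u(x)|\leq C(d^S(p,x)+1)^d \text{ for some } C\}$.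
   Formalization: For finite G (D = 0) the bound C(S) d^{D-1} = C(S)/d is false, since constants are harmonic and the dimension is 1 for every d; in that case the exponent D-1 is read as 0. For D ≥ 1 the statement is unchanged. *)

theory Defs
  imports "HOL-Analysis.Analysis" "HOL-Algebra.Algebra" "HOL-Library.Function_Algebras"
begin

definition word_dist :: "('a, 'b) monoid_scheme \<Rightarrow> 'a set \<Rightarrow> 'a \<Rightarrow> 'a \<Rightarrow> nat" where
  "word_dist G S x y =
     (LEAST n. \<exists>ss. length ss = n \<and> set ss \<subseteq> S \<and> y = foldl (\<otimes>\<^bsub>G\<^esub>) x ss)"

definition word_ball :: "('a, 'b) monoid_scheme \<Rightarrow> 'a set \<Rightarrow> 'a \<Rightarrow> nat \<Rightarrow> 'a set" where
  "word_ball G S p n = {x \<in> carrier G. word_dist G S x p \<le> n}"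

definition growth :: "('a, 'b) monoid_scheme \<Rightarrow> 'a set \<Rightarrow> nat \<Rightarrow> nat" where
  "growth G S n = card (word_ball G S \<one>\<^bsub>G\<^esub> n)"

text \<open>Laplacian: sum over the neighbours y ~ x, i.e. y = x s with s in S (S symmetric).\<close>
definition laplacian :: "('a, 'b) monoid_scheme \<Rightarrow> 'a set \<Rightarrow> ('a \<Rightarrow> real) \<Rightarrow> 'a \<Rightarrow> real" where
  "laplacian G S u x = (\<Sum>y \<in> {y \<in> carrier G. \<exists>s\<in>S. x = y \<otimes>\<^bsub>G\<^esub> s}. u y - u x)"

text \<open>Real functions on G, represented as functions on the carrier that vanish outside it.\<close>
definition harm_poly :: "('a, 'b) monoid_scheme \<Rightarrow> 'a set \<Rightarrow> 'a \<Rightarrow> real \<Rightarrow> ('a \<Rightarrow> real) set" where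
  "harm_poly G S p d = {u. (\<forall>x. x \<notin> carrier G \<longrightarrow> u x = 0)
      \<and> (\<forall>x\<in>carrier G. laplacian G S u x = 0)
      \<and> (\<exists>C. \<forall>x\<in>carrier G. \<bar>u x\<bar> \<le> C * (real (word_dist G S p x) + 1) powr d)}"

definition fscale :: "real \<Rightarrow> ('a \<Rightarrow> real) \<Rightarrow> ('a \<Rightarrow> real)" where
  "fscale c u = (\<lambda>x. c * u x)"

definition fun_dim :: "('a \<Rightarrow> real) set \<Rightarrow> nat" where
  "fun_dim V = vector_space.dim fscale V"

definition fun_finite_dim :: "('a \<Rightarrow> real) set \<Rightarrow> bool" where
  "fun_finite_dim V = (\<exists>B. finite B \<and> V \<subseteq> module.span fscale B)"

end

theory Submission
  imports Defs
begin

text \<open>Fix independent harmonic functions \<open>v\<^sub>1, \<dots>, v\<^sub>q\<close> of growth at most \<open>K = \<lceil>d\<rceil>\<close> and let \<open>g R\<close> be their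
  Gram determinant on the ball of radius \<open>R\<close>. It is polynomially bounded, so \<open>g (2 N) \<le> 2\<^bsup>O(qK)\<^esup> g N\<close> at some
  scale \<open>N\<close>. Split \<open>[N, 2 N]\<close> into \<open>K\<close> equal steps. At each step cover the smaller ball by Whitney balls
  relative to the larger one. A harmonic function with mean zero on every Whitney ball loses a large
  constant factor in \<open>L\<^sup>2\<close> norm when passing to the smaller ball, by the Poincare inequality on each
  Whitney ball and Caccioppoli's inequality with the distance to the boundary as cutoff. Hence \<open>g\<close> grows
  by a large constant to the power \<open>q\<close> minus the number of Whitney balls, and comparing with the
  bound on \<open>g (2 N) / g N\<close> shows that \<open>q\<close> is at most twice the average number of Whitney balls. Averaging over the
  steps replaces a bound on the volume of spheres: each annulus around the boundary contributes its
  average volume, and for \<open>D \<ge> 2\<close> the average number is \<open>O(K\<^bsup>D - 1\<^esup>)\<close>. For \<open>D \<le> 1\<close> the volume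
  of spheres is bounded along a subsequence, and their values on a sphere determine harmonic
  functions inside.\<close>

subsection \<open>Gram determinants of families of functions\<close>

interpretation fs: vector_space fscale
  by unfold_locales (auto simp: fscale_def fun_eq_iff algebra_simps)

lemma fscale_apply: "fscale c u x = c * u x"
  by (simp add: fscale_def)

text \<open>The form is only positive semidefinite, since functions vanishing on \<open>F\<close>
  have norm zero.\<close>

definition ip :: "'a set \<Rightarrow> ('a \<Rightarrow> real) \<Rightarrow> ('a \<Rightarrow> real) \<Rightarrow> real" where
  "ip F u v = (\<Sum>x\<in>F. u x * v x)"

lemma ip_add_left: "ip F (u + v) w = ip F u w + ip F v w"
  by (simp add: ip_def sum.distrib algebra_simps)

lemma ip_diff_left: "ip F (u - v) w = ip F u w - ip F v w"
  by (simp add: ip_def sum_subtractf algebra_simps)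

lemma ip_scale_left: "ip F (fscale c u) w = c * ip F u w"
  by (simp add: ip_def fscale_apply sum_distrib_left algebra_simps)

lemma ip_commute: "ip F u v = ip F v u"
  by (simp add: ip_def mult.commute)

lemma ip_add_right: "ip F w (u + v) = ip F w u + ip F w v"
  by (simp add: ip_commute[of F w] ip_add_left)

lemma ip_diff_right: "ip F w (u - v) = ip F w u - ip F w v"
  by (simp add: ip_commute[of F w] ip_diff_left)

lemma ip_scale_right: "ip F w (fscale c u) = c * ip F w u"
  by (simp add: ip_commute[of F w] ip_scale_left)

lemmas ip_linear = ip_add_left ip_add_right ip_diff_left ip_diff_right ip_scale_left ip_scale_right

lemma ip_self_nonneg: "ip F u u \<ge> 0"
  by (auto simp: ip_def intro!: sum_nonneg)

lemma ip_self_mono: "finite F' \<Longrightarrow> F \<subseteq> F' \<Longrightarrow> ip F u u \<le> ip F' u u"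
  by (auto simp: ip_def intro!: sum_mono2)

lemma ip_self_eq_0:
  assumes "finite F" "ip F r r = 0"
  shows "ip F u r = 0"
proof -
  have "\<forall>x\<in>F. r x = 0"
    using assms sum_nonneg_eq_0_iff[of F "\<lambda>x. r x * r x"] by (auto simp: ip_def)
  then show ?thesis by (simp add: ip_def)
qed

text \<open>Gram-Schmidt by induction: the projection onto the span of the tail is corrected along
  the residual \<open>r\<close> of the new vector \<open>w\<close>, which is orthogonal to that
  span.\<close>

lemma exists_projection:
  assumes "finite F"
  shows "\<exists>p\<in>fs.span (set vs). \<forall>s\<in>fs.span (set vs). ip F (v - p) s = 0"
proof (induction vs arbitrary: v)
  case Nil
  then show ?case by (auto simp: ip_def)
next
  case (Cons w vs)
  obtain p where p: "p \<in> fs.span (set vs)" "\<And>s. s \<in> fs.span (set vs) \<Longrightarrow> ip F (v - p) s = 0"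
    using Cons.IH[of v] by blast
  obtain q where q: "q \<in> fs.span (set vs)" "\<And>s. s \<in> fs.span (set vs) \<Longrightarrow> ip F (w - q) s = 0"
    using Cons.IH[of w] by blast
  define r where "r = w - q"
  \<comment> \<open>If \<open>r\<close> has norm zero, division by zero gives \<open>c = 0\<close>,
    which is correct because \<open>r\<close> then vanishes on \<open>F\<close> and is orthogonal to
    everything.\<close>
  define c where "c = ip F (v - p) r / ip F r r"
  have cr: "ip F (v - p) r = c * ip F r r"
    using ip_self_eq_0[OF assms, of r] by (cases "ip F r r = 0") (auto simp: c_def)
  have sub: "fs.span (set vs) \<subseteq> fs.span (set (w # vs))"
    by (rule fs.span_mono) auto
  have rin: "r \<in> fs.span (set (w # vs))"
    unfolding r_def using q(1) sub by (auto intro!: fs.span_diff intro: fs.span_base)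
  have "p + fscale c r \<in> fs.span (set (w # vs))"
    using p(1) sub rin by (auto intro!: fs.span_add fs.span_scale)
  moreover have "ip F (v - (p + fscale c r)) s = 0" if s: "s \<in> fs.span (set (w # vs))" for s
  proof -
    obtain k where k: "s - fscale k w \<in> fs.span (set vs)"
      using s fs.span_insert[of w "set vs"] by auto
    define t where "t = s - fscale k w + fscale k q"
    have t: "t \<in> fs.span (set vs)"
      unfolding t_def using k q(1) by (auto intro!: fs.span_add fs.span_scale)
    have st: "s = t + fscale k r" by (auto simp: t_def r_def fscale_apply fun_eq_iff algebra_simps)
    show ?thesis
      using p(2)[OF t] q(2)[OF t] cr
      by (simp add: st ip_linear r_def[symmetric] algebra_simps)
  qed
  ultimately show ?case by blast
qed

text \<open>As an infimum, the distance can be shifted and compared between different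
  \<open>F\<close> without choosing projections; \<open>dist_sq_eq\<close> identifies it with the
  squared norm of a residual.\<close>

definition dist_sq :: "'a set \<Rightarrow> ('a \<Rightarrow> real) \<Rightarrow> ('a \<Rightarrow> real) set \<Rightarrow> real" where
  "dist_sq F v U = (INF s\<in>U. ip F (v - s) (v - s))"

lemma dist_sq_bdd: "bdd_below ((\<lambda>s. ip F (v - s) (v - s)) ` U)"
  by (rule bdd_belowI[of _ 0]) (auto simp: ip_self_nonneg)

lemma dist_sq_nonneg: "U \<noteq> {} \<Longrightarrow> dist_sq F v U \<ge> 0"
  unfolding dist_sq_def by (intro cINF_greatest) (auto simp: ip_self_nonneg)

lemma span_nonempty: "fs.span B \<noteq> {}"
  using fs.span_zero[of B] by blast

lemma dist_sq_le: "s \<in> U \<Longrightarrow> dist_sq F v U \<le> ip F (v - s) (v - s)"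
  unfolding dist_sq_def by (rule cINF_lower[OF dist_sq_bdd])

text \<open>Pythagoras: \<open>v - s\<close> splits into the residual \<open>v - p\<close> and the
  vector \<open>p - s\<close> of the span, which is orthogonal to it.\<close>

lemma dist_sq_eq:
  assumes "p \<in> fs.span B" "\<And>s. s \<in> fs.span B \<Longrightarrow> ip F (v - p) s = 0"
  shows "dist_sq F v (fs.span B) = ip F (v - p) (v - p)"
proof (rule antisym)
  show "dist_sq F v (fs.span B) \<le> ip F (v - p) (v - p)"
    by (rule dist_sq_le) fact
  show "ip F (v - p) (v - p) \<le> dist_sq F v (fs.span B)"
    unfolding dist_sq_def
  proof (rule cINF_greatest)
    show "fs.span B \<noteq> {}" using assms(1) by blast
    fix s assume s: "s \<in> fs.span B"
    then have "ip F (v - p) (p - s) = 0"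
      using assms by (intro assms(2) fs.span_diff)
    moreover have "v - s = (v - p) + (p - s)" by simp
    then have "ip F (v - s) (v - s) = ip F (v - p) (v - p) + ip F (p - s) (p - s) + 2 * ip F (v - p) (p - s)"
      by (simp only: ip_add_left ip_add_right ip_commute[of F "p - s" "v - p"])
    ultimately show "ip F (v - p) (v - p) \<le> ip F (v - s) (v - s)"
      using ip_self_nonneg[of F "p - s"] by simp
  qed
qed

lemma dist_sq_shift:
  assumes "t \<in> fs.span B"
  shows "dist_sq F (v + t) (fs.span B) = dist_sq F v (fs.span B)"
proof -
  have "(\<lambda>s. ip F (v + t - s) (v + t - s)) ` fs.span B = (\<lambda>s. ip F (v - s) (v - s)) ` fs.span B"
  proof (intro equalityI image_subsetI)
    fix s assume s: "s \<in> fs.span B"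
    show "ip F (v + t - s) (v + t - s) \<in> (\<lambda>s. ip F (v - s) (v - s)) ` fs.span B"
      using s assms by (intro image_eqI[where x = "s - t"]) (auto intro: fs.span_diff simp: algebra_simps)
    show "ip F (v - s) (v - s) \<in> (\<lambda>s. ip F (v + t - s) (v + t - s)) ` fs.span B"
      using s assms by (intro image_eqI[where x = "s + t"]) (auto intro: fs.span_add)
  qed
  then show ?thesis by (simp add: dist_sq_def)
qed

lemma dist_sq_mono:
  assumes "U \<noteq> {}" and "\<And>s. s \<in> U \<Longrightarrow> ip F (v - s) (v - s) \<le> c * ip F' (v - s) (v - s)" and "c > 0"
  shows "dist_sq F v U \<le> c * dist_sq F' v U"
proof -
  have "dist_sq F v U / c \<le> dist_sq F' v U"
    unfolding dist_sq_def[of F']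
  proof (rule cINF_greatest)
    fix s assume "s \<in> U"
    then have "dist_sq F v U \<le> c * ip F' (v - s) (v - s)"
      using dist_sq_le[of s U F v] assms(2)[of s] by linarith
    then show "dist_sq F v U / c \<le> ip F' (v - s) (v - s)"
      using assms(3) by (simp add: field_simps)
  qed fact
  then show ?thesis using assms(3) by (simp add: field_simps)
qed

text \<open>The right-hand side is the 2 by 2 Gram determinant of the residuals of \<open>v\<close>
  and \<open>w\<close>. Its symmetry in \<open>v\<close> and \<open>w\<close> is what makes
  \<open>gram\<close> independent of the order of the list.\<close>

lemma dist_sq_insert:
  assumes fin: "finite F"
    and p: "p \<in> fs.span (set vs)" "\<And>s. s \<in> fs.span (set vs) \<Longrightarrow> ip F (v - p) s = 0"
    and q: "q \<in> fs.span (set vs)" "\<And>s. s \<in> fs.span (set vs) \<Longrightarrow> ip F (w - q) s = 0"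
  shows "dist_sq F w (fs.span (insert v (set vs))) * dist_sq F v (fs.span (set vs))
           = ip F (w - q) (w - q) * ip F (v - p) (v - p) - (ip F (w - q) (v - p))\<^sup>2"
proof -
  define r where "r = v - p"
  define t where "t = w - q"
  define c where "c = ip F t r / ip F r r"
  have cr: "ip F t r = c * ip F r r"
    using ip_self_eq_0[OF fin, of r] by (cases "ip F r r = 0") (auto simp: c_def)
  have sub: "fs.span (set vs) \<subseteq> fs.span (insert v (set vs))"
    by (rule fs.span_mono) auto
  have "r \<in> fs.span (insert v (set vs))"
    unfolding r_def using p(1) sub by (auto intro!: fs.span_diff intro: fs.span_base)
  then have "q + fscale c r \<in> fs.span (insert v (set vs))"
    using q(1) sub by (auto intro!: fs.span_add fs.span_scale)
  moreover have "ip F (w - (q + fscale c r)) s = 0" if s: "s \<in> fs.span (insert v (set vs))" for s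
  proof -
    obtain k where k: "s - fscale k v \<in> fs.span (set vs)"
      using s fs.span_insert[of v "set vs"] by auto
    define z where "z = s - fscale k v + fscale k p"
    have z: "z \<in> fs.span (set vs)"
      unfolding z_def using k p(1) by (auto intro!: fs.span_add fs.span_scale)
    have st: "s = z + fscale k r" by (auto simp: z_def r_def fscale_apply fun_eq_iff algebra_simps)
    have w: "w - (q + fscale c r) = t - fscale c r" by (simp add: t_def algebra_simps)
    show ?thesis
      using p(2)[OF z] q(2)[OF z] cr
      unfolding w st by (simp add: ip_linear r_def[symmetric] t_def[symmetric] algebra_simps)
  qed
  ultimately have "dist_sq F w (fs.span (insert v (set vs)))
      = ip F (w - (q + fscale c r)) (w - (q + fscale c r))"
    by (rule dist_sq_eq)
  also have "w - (q + fscale c r) = t - fscale c r" by (simp add: t_def algebra_simps)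
  also have "ip F (t - fscale c r) (t - fscale c r) = ip F t t - 2 * c * ip F t r + c * c * ip F r r"
    using ip_commute[of F r t] by (simp add: ip_linear algebra_simps)
  finally have "dist_sq F w (fs.span (insert v (set vs))) = ip F t t - c * ip F t r"
    using cr by (simp only: mult.assoc)
  moreover have "dist_sq F v (fs.span (set vs)) = ip F r r"
    unfolding r_def using p by (rule dist_sq_eq)
  ultimately show ?thesis
    unfolding r_def[symmetric] t_def[symmetric] cr
    by (simp only: left_diff_distrib right_diff_distrib power2_eq_square mult.assoc mult.left_commute mult.commute)
qed

section \<open>Gram determinants under permutation, elimination and change of domain\<close>

text \<open>The Gram determinant of a list of functions on \<open>F\<close>, computed as a product of squared
  distances, so that comparing two sets \<open>F\<close> needs no matrices.\<close>
fun gram :: "'a set \<Rightarrow> ('a \<Rightarrow> real) list \<Rightarrow> real" where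
  "gram F [] = 1"
| "gram F (v # vs) = dist_sq F v (fs.span (set vs)) * gram F vs"

lemma gram_nonneg: "gram F vs \<ge> 0"
  by (induction vs) (auto intro!: mult_nonneg_nonneg dist_sq_nonneg span_nonempty)

lemma gram_swap:
  assumes "finite F"
  shows "gram F (v # w # vs) = gram F (w # v # vs)"
proof -
  obtain p where p: "p \<in> fs.span (set vs)" "\<And>s. s \<in> fs.span (set vs) \<Longrightarrow> ip F (v - p) s = 0"
    using exists_projection[OF assms] by blast
  obtain q where q: "q \<in> fs.span (set vs)" "\<And>s. s \<in> fs.span (set vs) \<Longrightarrow> ip F (w - q) s = 0"
    using exists_projection[OF assms] by blast
  have "dist_sq F w (fs.span (insert v (set vs))) * dist_sq F v (fs.span (set vs))
      = dist_sq F v (fs.span (insert w (set vs))) * dist_sq F w (fs.span (set vs))"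
    using dist_sq_insert[OF assms p q] dist_sq_insert[OF assms q p]
    by (simp add: ip_commute mult.commute)
  then show ?thesis by (simp add: algebra_simps)
qed

lemma gram_move:
  assumes "finite F"
  shows "gram F (xs @ v # ys) = gram F (v # xs @ ys)"
proof (induction xs)
  case (Cons x xs)
  have "gram F (x # (xs @ v # ys)) = gram F (x # v # xs @ ys)"
    using Cons unfolding gram.simps(2)[of F x] by (simp only: set_append list.set Un_insert_right append_Cons)
  then show ?case by (simp only: append_Cons gram_swap[OF assms, of x v "xs @ ys"])
qed simp

text \<open>Adjacent swaps generate all permutations, so the recursion depends on the multiset
  only.\<close>

lemma gram_perm:
  assumes "finite F" "mset xs = mset ys"
  shows "gram F xs = gram F ys"
  using assms(2)
proof (induction xs arbitrary: ys)
  case (Cons x xs)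
  then obtain ys1 ys2 where ys: "ys = ys1 @ x # ys2"
    by (metis list.set_intros(1) mset_eq_setD split_list)
  with Cons.prems have "mset xs = mset (ys1 @ ys2)" by simp
  then have "gram F xs = gram F (ys1 @ ys2)" "set xs = set (ys1 @ ys2)"
    using Cons.IH mset_eq_setD by blast+
  then show ?case using gram_move[OF assms(1), of ys1 x ys2] by (simp add: ys)
qed simp

lemma span_shear:
  "fs.span (set (map (\<lambda>x. x + fscale (c x) w) xs @ w # us)) = fs.span (set (xs @ w # us))"
  (is "?L = ?R")
proof
  show "?L \<subseteq> ?R"
    by (rule fs.span_minimal)
      (auto intro!: fs.span_add fs.span_scale intro: fs.span_base)
  have "x \<in> ?L" if "x \<in> set xs" for x
  proof -
    have "(x + fscale (c x) w) - fscale (c x) w \<in> ?L"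
      using that by (intro fs.span_diff fs.span_scale fs.span_base) auto
    then show ?thesis by simp
  qed
  then show "?R \<subseteq> ?L"
    by (intro fs.span_minimal) (auto intro: fs.span_base)
qed

text \<open>The vector \<open>w\<close> stays in the tail, so each added multiple of it lies in the
  span to which the distance is measured.\<close>

lemma gram_shear:
  "gram F (map (\<lambda>x. x + fscale (c x) w) xs @ w # us) = gram F (xs @ w # us)"
proof (induction xs)
  case (Cons x xs)
  have "fscale (c x) w \<in> fs.span (set (xs @ w # us))"
    by (intro fs.span_scale fs.span_base) auto
  then have "dist_sq F (x + fscale (c x) w) (fs.span (set (xs @ w # us))) = dist_sq F x (fs.span (set (xs @ w # us)))"
    by (rule dist_sq_shift)
  then show ?case
    using Cons span_shear[of c w xs us] by (simp only: list.map append_Cons gram.simps)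
qed simp

text \<open>Gaussian elimination with respect to the linear functionals \<open>ls\<close>.\<close>
lemma gram_adapted_list:
  assumes "\<And>l. l \<in> set ls \<Longrightarrow> (\<forall>u v c. l (u + fscale c v) = l u + c * l v)"
  shows "\<exists>us ws. length us \<le> length ls \<and> length us + length ws = length vs
    \<and> set (us @ ws) \<subseteq> fs.span (set vs)
    \<and> (\<forall>l\<in>set ls. \<forall>w\<in>set ws. l w = 0) \<and> (\<forall>F. finite F \<longrightarrow> gram F (us @ ws) = gram F vs)"
  using assms
proof (induction ls)
  case Nil
  show ?case by (intro exI[of _ "[]"] exI[of _ vs]) (auto intro: fs.span_base)
next
  case (Cons l ls)
  then obtain us ws where IH: "length us \<le> length ls" "length us + length ws = length vs"
    "set (us @ ws) \<subseteq> fs.span (set vs)" "\<And>l w. l \<in> set ls \<Longrightarrow> w \<in> set ws \<Longrightarrow> l w = 0"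
    "\<And>F. finite F \<Longrightarrow> gram F (us @ ws) = gram F vs"
    by (metis list.set_intros(2))
  have lin: "l (u + fscale c v) = l u + c * l v" for u v c
    using Cons.prems[OF list.set_intros(1)] by blast
  show ?case
  proof (cases "\<forall>w\<in>set ws. l w = 0")
    case True
    then show ?thesis using IH by (intro exI[of _ us] exI[of _ ws]) auto
  next
    case False
    then obtain w where w: "w \<in> set ws" "l w \<noteq> 0" by blast
    then obtain ws1 ws2 where ws: "ws = ws1 @ w # ws2" by (meson split_list)
    \<comment> \<open>\<open>w\<close> becomes the pivot for \<open>l\<close> and joins
      \<open>us\<close>; subtracting multiples of it makes \<open>l\<close> vanish on the rest. The
      functionals treated before vanish on \<open>w\<close> as well, so they stay zero.\<close>
    define f where "f = (\<lambda>x. x + fscale (- l x / l w) w)"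
    define ws' where "ws' = map f (ws1 @ ws2)"
    have "gram F ((w # us) @ ws') = gram F vs" if fin: "finite F" for F
    proof -
      \<comment> \<open>\<open>gram_shear\<close> expects the pivot after the sheared vectors, hence
        the permutations before and after it.\<close>
      have "gram F ((w # us) @ ws') = gram F (ws' @ w # us)"
        by (rule gram_perm[OF fin]) simp
      also have "\<dots> = gram F ((ws1 @ ws2) @ w # us)"
        unfolding ws'_def f_def by (rule gram_shear)
      also have "\<dots> = gram F (us @ ws)"
        by (rule gram_perm[OF fin]) (simp add: ws)
      finally show ?thesis using IH(5)[OF fin] by simp
    qed
    moreover have "\<forall>l'\<in>set (l # ls). \<forall>w\<in>set ws'. l' w = 0"
    proof (intro ballI)
      fix l' x' assume l': "l' \<in> set (l # ls)" and "x' \<in> set ws'"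
      then obtain x where x: "x \<in> set ws" "x' = f x"
        by (auto simp: ws'_def ws)
      have "l' x' = l' x + (- l x / l w) * l' w"
        using Cons.prems[OF l'] x unfolding f_def by blast
      then show "l' x' = 0"
        using l' w IH(4)[of l' x] IH(4)[of l' w] x(1) by auto
    qed
    moreover have "set ((w # us) @ ws') \<subseteq> fs.span (set vs)"
    proof -
      have "f x \<in> fs.span (set vs)" if "x \<in> set ws" for x
        unfolding f_def using that w IH(3) by (intro fs.span_add fs.span_scale) auto
      then show ?thesis using IH(3) w by (auto simp: ws'_def ws)
    qed
    moreover have "length (w # us) \<le> length (l # ls)" "length (w # us) + length ws' = length vs"
      using IH(1,2) by (auto simp: ws'_def ws)
    ultimately show ?thesis by blast
  qed
qed

text \<open>The products of distances are compared factor by factor. With \<open>ws\<close> at the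
  end, its distances involve only the span of \<open>ws\<close>, where the squared norm contracts by
  \<open>c\<close>; the distances of \<open>us\<close> merely do not increase on passing from
  \<open>F'\<close> to \<open>F\<close>.\<close>

lemma gram_contract:
  assumes "finite F'" "F \<subseteq> F'" "c > 0"
    and contr: "\<And>u. u \<in> fs.span (set ws) \<Longrightarrow> ip F u u \<le> c * ip F' u u"
  shows "gram F (us @ ws) \<le> c ^ length ws * gram F' (us @ ws)"
proof (induction us)
  case Nil
  show ?case using contr
  proof (induction ws)
    case (Cons w ws)
    have sub: "fs.span (set ws) \<subseteq> fs.span (set (w # ws))" by (rule fs.span_mono) auto
    have "dist_sq F w (fs.span (set ws)) \<le> c * dist_sq F' w (fs.span (set ws))"
    proof (rule dist_sq_mono)
      fix s assume "s \<in> fs.span (set ws)"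
      then have "w - s \<in> fs.span (set (w # ws))"
        using sub by (intro fs.span_diff) (auto intro: fs.span_base)
      then show "ip F (w - s) (w - s) \<le> c * ip F' (w - s) (w - s)" by (rule Cons.prems)
    qed (use assms fs.span_zero in auto)
    moreover have "gram F ws \<le> c ^ length ws * gram F' ws"
      using Cons.IH Cons.prems sub unfolding append_Nil by blast
    ultimately have "dist_sq F w (fs.span (set ws)) * gram F ws
        \<le> (c * dist_sq F' w (fs.span (set ws))) * (c ^ length ws * gram F' ws)"
      using assms(3) by (intro mult_mono gram_nonneg mult_nonneg_nonneg dist_sq_nonneg span_nonempty) (use span_nonempty in auto)
    then show ?case by (simp add: algebra_simps)
  qed simp
next
  case (Cons u us)
  have "dist_sq F u (fs.span (set (us @ ws))) \<le> 1 * dist_sq F' u (fs.span (set (us @ ws)))"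
    using fs.span_zero ip_self_mono[OF assms(1,2)] by (intro dist_sq_mono) auto
  then have "dist_sq F u (fs.span (set (us @ ws))) * gram F (us @ ws)
      \<le> dist_sq F' u (fs.span (set (us @ ws))) * (c ^ length ws * gram F' (us @ ws))"
    using Cons by (intro mult_mono gram_nonneg dist_sq_nonneg span_nonempty) (use span_nonempty in auto)
  then show ?case by (simp add: algebra_simps)
qed

text \<open>Hadamard's inequality: the distance to a span is at most the distance to 0.\<close>

lemma gram_le_prod: "gram F vs \<le> (\<Prod>v\<leftarrow>vs. ip F v v)"
proof (induction vs)
  case (Cons v vs)
  have "dist_sq F v (fs.span (set vs)) \<le> ip F v v"
    using dist_sq_le[OF fs.span_zero, of F v] by simp
  then show ?case using Cons
    by (auto intro!: mult_mono gram_nonneg ip_self_nonneg)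
qed simp

text \<open>If the set for the tail fails for the longer list, the functions of the larger span
  vanishing on it form a line, and one extra point where its generator \<open>u0\<close> is nonzero
  suffices.\<close>

lemma exists_determining_set:
  "\<exists>F. finite F \<and> (\<forall>u\<in>fs.span (set vs). (\<forall>x\<in>F. u x = 0) \<longrightarrow> u = 0)"
proof (induction vs)
  case Nil
  show ?case by (intro exI[of _ "{}"]) auto
next
  case (Cons v vs)
  then obtain F where F: "finite F" "\<And>u. u \<in> fs.span (set vs) \<Longrightarrow> (\<forall>x\<in>F. u x = 0) \<Longrightarrow> u = 0"
    by blast
  show ?case
  proof (cases "\<exists>u\<in>fs.span (set (v # vs)). (\<forall>x\<in>F. u x = 0) \<and> u \<noteq> 0")
    case False
    then show ?thesis using F by blast
  next
    case True
    then obtain u0 where u0: "u0 \<in> fs.span (set (v # vs))" "\<And>x. x \<in> F \<Longrightarrow> u0 x = 0" "u0 \<noteq> 0"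
      by blast
    then obtain x0 where x0: "u0 x0 \<noteq> 0" by (auto simp: fun_eq_iff)
    obtain a where a: "u0 - fscale a v \<in> fs.span (set vs)"
      using u0(1) fs.span_insert[of v "set vs"] by auto
    have a0: "a \<noteq> 0"
    proof
      assume "a = 0"
      then have "u0 \<in> fs.span (set vs)" using a by (simp add: fscale_def zero_fun_def[symmetric])
      then show False using F(2)[of u0] u0 by blast
    qed
    have "u = 0" if u: "u \<in> fs.span (set (v # vs))" "\<forall>x\<in>insert x0 F. u x = 0" for u
    proof -
      obtain b where b: "u - fscale b v \<in> fs.span (set vs)"
        using u(1) fs.span_insert[of v "set vs"] by auto
      \<comment> \<open>The multiple of \<open>u0\<close> cancels the component along
        \<open>v\<close>, so the difference lies in the span of the tail, where \<open>F\<close> is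
        determining.\<close>
      have "(u - fscale b v) - fscale (b / a) (u0 - fscale a v) = u - fscale (b / a) u0"
        using a0 by (auto simp: fun_eq_iff fscale_apply field_simps)
      moreover have "(u - fscale b v) - fscale (b / a) (u0 - fscale a v) \<in> fs.span (set vs)"
        by (rule fs.span_diff[OF b fs.span_scale[OF a]])
      moreover have "\<forall>x\<in>F. (u - fscale (b / a) u0) x = 0"
        using u(2) u0(2) by (simp add: fscale_apply)
      ultimately have "u - fscale (b / a) u0 = 0"
        by (intro F(2)) (simp_all only:)
      then have eq: "u x = b / a * u0 x" for x by (simp add: fun_eq_iff fscale_apply)
      then show "u = 0" using eq[of x0] u(2) x0 by (auto simp: fun_eq_iff)
    qed
    moreover have "finite (insert x0 F)" using F(1) by simp
    ultimately show ?thesis by blast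
  qed
qed

text \<open>A zero factor would make a residual \<open>v - p\<close> vanish on \<open>F\<close>,
  hence everywhere by \<open>det\<close>, and \<open>v\<close> would lie in the span of the
  tail.\<close>

lemma gram_pos:
  assumes "finite F" "distinct vs" "fs.independent (set vs)"
    and det: "\<And>u. u \<in> fs.span (set vs) \<Longrightarrow> (\<forall>x\<in>F. u x = 0) \<Longrightarrow> u = 0"
  shows "gram F vs > 0"
  using assms(2-)
proof (induction vs)
  case (Cons v vs)
  have sub: "fs.span (set vs) \<subseteq> fs.span (set (v # vs))" by (rule fs.span_mono) auto
  obtain p where p: "p \<in> fs.span (set vs)" "\<And>s. s \<in> fs.span (set vs) \<Longrightarrow> ip F (v - p) s = 0"
    using exists_projection[OF assms(1)] by blast
  have "ip F (v - p) (v - p) \<noteq> 0"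
  proof
    assume "ip F (v - p) (v - p) = 0"
    then have "\<forall>x\<in>F. (v - p) x = 0"
      using sum_nonneg_eq_0_iff[OF assms(1), of "\<lambda>x. (v - p) x * (v - p) x"] by (simp add: ip_def)
    moreover have "v - p \<in> fs.span (set (v # vs))"
      using p(1) sub by (intro fs.span_diff) (auto intro: fs.span_base)
    ultimately have "v - p = 0" using Cons.prems(3)[of "v - p"] by blast
    then have "v \<in> fs.span (set vs)" using p(1) by simp
    then show False using Cons.prems(1,2) fs.independent_insert[of v "set vs"] by auto
  qed
  then have "dist_sq F v (fs.span (set vs)) > 0"
    using dist_sq_eq[OF p] ip_self_nonneg[of F "v - p"] by simp
  moreover have "gram F vs > 0"
    using Cons.prems sub fs.independent_mono[of "set (v # vs)" "set vs"]
    by (intro Cons.IH) auto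
  ultimately show ?case by simp
qed simp

text \<open>An infinite basis has cardinality 0 by convention, so a bound on \<open>fun_dim\<close>
  alone would not give finite dimension. Bounding all finite independent lists excludes an infinite
  basis first.\<close>

lemma fun_dim_le:
  assumes "\<And>vs. distinct vs \<Longrightarrow> set vs \<subseteq> V \<Longrightarrow> fs.independent (set vs) \<Longrightarrow> real (length vs) \<le> c"
  shows "fun_finite_dim V \<and> real (fun_dim V) \<le> c"
proof -
  obtain B where B: "B \<subseteq> V" "fs.independent B" "V \<subseteq> fs.span B" "card B = fs.dim V"
    using fs.basis_exists by blast
  have "finite B"
  proof (rule ccontr)
    assume "infinite B"
    then obtain B' where B': "B' \<subseteq> B" "finite B'" "card B' = nat \<lceil>c\<rceil> + 1"
      using infinite_arbitrarily_large by blast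
    obtain vs where vs: "set vs = B'" "distinct vs" using B'(2) finite_distinct_list by blast
    then have "real (length vs) \<le> c"
      using B B' fs.independent_mono[OF B(2) B'(1)] by (intro assms) auto
    moreover have "length vs = nat \<lceil>c\<rceil> + 1" using vs B'(3) distinct_card by fastforce
    ultimately show False by linarith
  qed
  then obtain vs where vs: "set vs = B" "distinct vs" using finite_distinct_list by blast
  then have "real (length vs) \<le> c" using B by (intro assms) auto
  then show ?thesis
    using vs B \<open>finite B\<close> distinct_card[of vs]
    by (auto simp: fun_finite_dim_def fun_dim_def)
qed

subsection \<open>Sums and counting\<close>

lemma sum_UN_le:
  fixes f :: "'b \<Rightarrow> real"
  assumes "finite I" "\<And>i. i \<in> I \<Longrightarrow> finite (A i)" "\<And>y. f y \<ge> 0"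
  shows "sum f (\<Union>i\<in>I. A i) \<le> (\<Sum>i\<in>I. sum f (A i))"
  using assms(1,2)
proof (induction I)
  case (insert i I)
  have "sum f (\<Union>i\<in>insert i I. A i) \<le> sum f (A i) + sum f (\<Union>i\<in>I. A i)"
    using insert.prems insert.hyps assms(3) sum.union_inter[of "A i" "\<Union>i\<in>I. A i" f]
      sum_nonneg[of "A i \<inter> (\<Union>i\<in>I. A i)" f] by auto
  with insert show ?case by simp
qed simp

text \<open>Variance identity: where \<open>f\<close> has mean zero, the sum of squares is
  controlled by the differences of pairs.\<close>

lemma sum_sq_pairs:
  fixes f :: "'b \<Rightarrow> real"
  shows "(\<Sum>x\<in>B. \<Sum>y\<in>B. (f y - f x)\<^sup>2) = 2 * real (card B) * (\<Sum>x\<in>B. (f x)\<^sup>2) - 2 * (sum f B)\<^sup>2"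
proof -
  have "(\<Sum>x\<in>B. \<Sum>y\<in>B. (f y - f x)\<^sup>2)
      = (\<Sum>x\<in>B. \<Sum>y\<in>B. (f y)\<^sup>2) + (\<Sum>x\<in>B. \<Sum>y\<in>B. (f x)\<^sup>2) - 2 * (\<Sum>x\<in>B. \<Sum>y\<in>B. f x * f y)"
    by (simp add: power2_diff sum.distrib sum_subtractf sum_distrib_left algebra_simps)
  also have "(\<Sum>x\<in>B. \<Sum>y\<in>B. f x * f y) = (sum f B)\<^sup>2"
    by (simp add: power2_eq_square sum_product)
  finally show ?thesis by (simp add: sum_distrib_left mult.assoc)
qed

text \<open>A geometric sum with ratio 4 is dominated by its largest term. Thus the overlap of all
  dyadic scales at one point costs only a constant.\<close>

lemma sum_dyadic_squares_le:
  fixes a b :: real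
  assumes "a \<ge> 0"
  shows "(\<Sum>s | s < n \<and> 2 ^ s * a \<le> b. (2 ^ s * a)\<^sup>2) \<le> 2 * b\<^sup>2"
proof (induction n)
  case (Suc n)
  show ?case
  proof (cases "2 ^ n * a \<le> b")
    case True
    have "(\<Sum>s | s < Suc n \<and> 2 ^ s * a \<le> b. (2 ^ s * a)\<^sup>2) \<le> (\<Sum>s<Suc n. (2 ^ s * a)\<^sup>2)"
      by (rule sum_mono2) auto
    also have "\<dots> \<le> 2 * (2 ^ n * a)\<^sup>2"
    proof (induction n)
      case (Suc k)
      have "(2 ^ Suc k * a)\<^sup>2 = 4 * (2 ^ k * a)\<^sup>2" by (simp add: power2_eq_square)
      then show ?case
        using Suc zero_le_power2[of "2 ^ k * a"] sum.lessThan_Suc[of "\<lambda>s. (2 ^ s * a)\<^sup>2" "Suc k"]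
        by linarith
    qed simp
    also have "\<dots> \<le> 2 * b\<^sup>2"
      using True assms by (simp add: power_mono)
    finally show ?thesis .
  next
    case False
    then have "{s. s < Suc n \<and> 2 ^ s * a \<le> b} = {s. s < n \<and> 2 ^ s * a \<le> b}"
      by (auto simp: less_Suc_eq)
    then show ?thesis using Suc by simp
  qed
qed simp

text \<open>The numbers \<open>N + Suc j * M\<close> are spaced by \<open>M\<close>, and the
  half-open window has length \<open>t * M\<close>.\<close>

lemma card_multiples_in_window:
  assumes "M > 0"
  shows "card {j. j < K \<and> d < N + Suc j * M \<and> N + Suc j * M \<le> d + t * M} \<le> (t::nat)"
    (is "card ?J \<le> t")
proof (cases "?J = {}")
  case False
  have fin: "finite ?J" by simp
  define j0 where "j0 = Min ?J"
  have j0: "j0 \<in> ?J" unfolding j0_def using fin False by (rule Min_in)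
  have "?J \<subseteq> {j0..<j0 + t}"
  proof
    fix j assume j: "j \<in> ?J"
    have "j < j0 + t"
    proof (rule ccontr)
      assume "\<not> j < j0 + t"
      then have "(Suc j0 + t) * M \<le> Suc j * M" by (intro mult_right_mono) auto
      then have "Suc j0 * M + t * M \<le> Suc j * M" by (simp only: add_mult_distrib)
      then show False using j j0 by auto
    qed
    then show "j \<in> {j0..<j0 + t}" using fin j by (auto simp: j0_def)
  qed
  then have "card ?J \<le> card {j0..<j0 + t}" by (intro card_mono) auto
  then show ?thesis by simp
next
  case True
  show ?thesis unfolding True by simp
qed

text \<open>If every doubling multiplied \<open>g\<close> by more than \<open>2 ^ Suc e\<close>,
  then \<open>g\<close> would outgrow every polynomial of degree \<open>e\<close> along the scales
  \<open>2 ^ i * N0\<close>.\<close>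

lemma exists_doubling_scale:
  fixes g :: "nat \<Rightarrow> real"
  assumes pos: "g N0 > 0" and "N0 \<ge> 1"
    and bound: "\<And>n. n \<ge> 1 \<Longrightarrow> g n \<le> B * real (n + 1) ^ e"
  shows "\<exists>i. g (2 * (2 ^ i * N0)) \<le> 2 ^ Suc e * g (2 ^ i * N0)"
proof (rule ccontr)
  assume "\<not> ?thesis"
  then have step: "g (2 * (2 ^ i * N0)) > 2 ^ Suc e * g (2 ^ i * N0)" for i by (auto simp: not_le)
  have low: "(2 ^ Suc e) ^ i * g N0 \<le> g (2 ^ i * N0)" for i
  proof (induction i)
    case (Suc i)
    have "(2 ^ Suc e) ^ Suc i * g N0 = 2 ^ Suc e * ((2 ^ Suc e) ^ i * g N0)" by simp
    also have "\<dots> \<le> 2 ^ Suc e * g (2 ^ i * N0)" using Suc by (intro mult_left_mono) auto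
    also have "\<dots> \<le> g (2 ^ Suc i * N0)" using step[of i] by (simp add: mult.assoc)
    finally show ?case .
  qed simp
  have Bpos: "B > 0"
  proof (rule ccontr)
    assume "\<not> B > 0"
    then have "B * real (N0 + 1) ^ e \<le> 0" by (intro mult_nonpos_nonneg) auto
    then show False using bound[OF \<open>N0 \<ge> 1\<close>] pos by linarith
  qed
  \<comment> \<open>Cancelling \<open>(2 ^ i) ^ e\<close> leaves one surplus factor 2 per doubling,
    which is the reason for \<open>Suc e\<close>.\<close>
  have "2 ^ i * g N0 \<le> B * real (N0 + 1) ^ e" for i
  proof -
    have "(1::nat) \<le> 2 ^ i * N0" using \<open>N0 \<ge> 1\<close> by (simp add: Suc_le_eq)
    then have "g (2 ^ i * N0) \<le> B * real (2 ^ i * N0 + 1) ^ e" by (rule bound)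
    also have "\<dots> \<le> B * (2 ^ i * real (N0 + 1)) ^ e"
      using Bpos by (intro mult_left_mono power_mono) (auto simp: algebra_simps)
    finally have "(2 ^ Suc e) ^ i * g N0 \<le> B * (2 ^ i * real (N0 + 1)) ^ e"
      using low[of i] by linarith
    moreover have "(2 ^ Suc e) ^ i * g N0 = (2 ^ i) ^ e * (2 ^ i * g N0)"
      by (simp add: power_mult[symmetric] power_add[symmetric] algebra_simps)
    moreover have "B * (2 ^ i * real (N0 + 1)) ^ e = (2 ^ i) ^ e * (B * real (N0 + 1) ^ e)"
      by (simp only: power_mult_distrib mult.left_commute)
    ultimately have "(2 ^ i) ^ e * (2 ^ i * g N0) \<le> (2 ^ i) ^ e * (B * real (N0 + 1) ^ e)" by (simp only:)
    then show ?thesis by (rule mult_left_le_imp_le) simp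
  qed
  moreover obtain i where "B * real (N0 + 1) ^ e / g N0 < 2 ^ i"
    using real_arch_pow[of 2] by auto
  ultimately show False using pos by (auto simp: field_simps not_le[symmetric])
qed

subsection \<open>Analysis on Cayley graphs\<close>

locale cayley = group G for G (structure) +
  fixes S
  assumes finite_S: "finite S" and S_sub: "S \<subseteq> carrier G"
    and S_inv: "s \<in> S \<Longrightarrow> inv s \<in> S" and S_gen: "generate G S = carrier G"
begin

abbreviation "dst \<equiv> word_dist G S"
abbreviation "wball \<equiv> word_ball G S"

section \<open>Words and the word metric\<close>

lemma S_carrier [simp]: "s \<in> S \<Longrightarrow> s \<in> carrier G"
  using S_sub by blast

lemma mult_inv_cancel:
  assumes "x \<in> carrier G" "y \<in> carrier G"
  shows "x \<otimes> (inv x \<otimes> y) = y" "inv x \<otimes> (x \<otimes> y) = y"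
  using assms by (simp_all add: m_assoc[symmetric])

lemma foldl_closed: "x \<in> carrier G \<Longrightarrow> set ss \<subseteq> S \<Longrightarrow> foldl (\<otimes>) x ss \<in> carrier G"
  by (induction ss arbitrary: x) auto

lemma foldl_mult:
  "g \<in> carrier G \<Longrightarrow> x \<in> carrier G \<Longrightarrow> set ss \<subseteq> S \<Longrightarrow> foldl (\<otimes>) (g \<otimes> x) ss = g \<otimes> foldl (\<otimes>) x ss"
  by (induction ss arbitrary: x) (auto simp: m_assoc)

lemma foldl_inverse:
  "x \<in> carrier G \<Longrightarrow> set ss \<subseteq> S \<Longrightarrow> foldl (\<otimes>) (foldl (\<otimes>) x ss) (map (\<lambda>s. inv s) (rev ss)) = x"
  by (induction ss arbitrary: x) (auto simp: m_assoc)

lemma exists_word: "g \<in> carrier G \<Longrightarrow> \<exists>ss. set ss \<subseteq> S \<and> g = foldl (\<otimes>) \<one> ss"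
  unfolding S_gen[symmetric]
proof (induction rule: generate.induct)
  case one
  show ?case by (intro exI[of _ "[]"]) auto
next
  case (incl h)
  then show ?case by (intro exI[of _ "[h]"]) auto
next
  case (inv h)
  then show ?case using S_inv by (intro exI[of _ "[inv h]"]) auto
next
  case (eng g h)
  then obtain ss ts where "set ss \<subseteq> S" "g = foldl (\<otimes>) \<one> ss" "set ts \<subseteq> S" "h = foldl (\<otimes>) \<one> ts"
    by blast
  then show ?case
    using foldl_mult[of "foldl (\<otimes>) \<one> ss" \<one> ts] foldl_closed[of \<one> ss]
    by (intro exI[of _ "ss @ ts"]) auto
qed

text \<open>The \<open>LEAST\<close> in \<open>word_dist\<close> is attained because some word leads
  from \<open>x\<close> to \<open>y\<close>. Metric facts are then proved by manipulating shortest
  words.\<close>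

lemma geodesic:
  assumes "x \<in> carrier G" "y \<in> carrier G"
  obtains ss where "length ss = dst x y" "set ss \<subseteq> S" "y = foldl (\<otimes>) x ss"
proof -
  obtain ss where "set ss \<subseteq> S" "inv x \<otimes> y = foldl (\<otimes>) \<one> ss"
    using exists_word[of "inv x \<otimes> y"] assms by auto
  then have "y = foldl (\<otimes>) x ss"
    using foldl_mult[of x \<one> ss] assms mult_inv_cancel(1)[of x y] by simp
  then have "\<exists>n ss. length ss = n \<and> set ss \<subseteq> S \<and> y = foldl (\<otimes>) x ss"
    using \<open>set ss \<subseteq> S\<close> by blast
  from LeastI_ex[OF this] show ?thesis using that unfolding word_dist_def by blast
qed

lemma dst_le: "set ss \<subseteq> S \<Longrightarrow> dst x (foldl (\<otimes>) x ss) \<le> length ss"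
  unfolding word_dist_def by (rule Least_le) blast

lemma dst_self [simp]: "dst x x = 0"
  using dst_le[of "[]" x] by simp

lemma dst_eq_0: "x \<in> carrier G \<Longrightarrow> y \<in> carrier G \<Longrightarrow> dst x y = 0 \<Longrightarrow> x = y"
  by (erule (1) geodesic) simp

lemma dst_triangle:
  assumes "x \<in> carrier G" "y \<in> carrier G" "z \<in> carrier G"
  shows "dst x z \<le> dst x y + dst y z"
proof -
  obtain ss where "length ss = dst x y" "set ss \<subseteq> S" "y = foldl (\<otimes>) x ss"
    by (rule geodesic[OF assms(1,2)])
  moreover obtain ts where "length ts = dst y z" "set ts \<subseteq> S" "z = foldl (\<otimes>) y ts"
    by (rule geodesic[OF assms(2,3)])
  ultimately show ?thesis using dst_le[of "ss @ ts" x] by simp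
qed

lemma dst_commute:
  assumes "x \<in> carrier G" "y \<in> carrier G"
  shows "dst x y = dst y x"
proof -
  have "dst y x \<le> dst x y" if xy: "x \<in> carrier G" "y \<in> carrier G" for x y
  proof -
    obtain ss where "length ss = dst x y" "set ss \<subseteq> S" "y = foldl (\<otimes>) x ss"
      by (rule geodesic[OF xy])
    then show ?thesis
      using dst_le[of "map (\<lambda>s. inv s) (rev ss)" y] foldl_inverse[of x ss] S_inv xy(1)
      by (auto simp: image_subset_iff subset_iff)
  qed
  then show ?thesis using assms by (simp add: antisym)
qed

text \<open>Edges are right multiplications and so commute with left multiplication; the opposite
  inequality comes from \<open>inv g\<close>.\<close>

lemma dst_mult_left:
  assumes "g \<in> carrier G" "x \<in> carrier G" "y \<in> carrier G"
  shows "dst (g \<otimes> x) (g \<otimes> y) = dst x y"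
proof -
  have le: "dst (g \<otimes> x) (g \<otimes> y) \<le> dst x y"
    if gxy: "g \<in> carrier G" "x \<in> carrier G" "y \<in> carrier G" for g x y
  proof -
    obtain ss where "length ss = dst x y" "set ss \<subseteq> S" "y = foldl (\<otimes>) x ss"
      by (rule geodesic[OF gxy(2,3)])
    then show ?thesis using dst_le[of ss "g \<otimes> x"] foldl_mult[of g x ss] that by simp
  qed
  have "dst (inv g \<otimes> (g \<otimes> x)) (inv g \<otimes> (g \<otimes> y)) \<le> dst (g \<otimes> x) (g \<otimes> y)"
    using assms by (intro le) auto
  then show ?thesis using le[of g x y] assms by (simp add: m_assoc[symmetric])
qed

lemma dst_step: "s \<in> S \<Longrightarrow> dst x (x \<otimes> s) \<le> 1"
  using dst_le[of "[s]" x] by simp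

lemma dst_step':
  assumes "p \<in> carrier G" "x \<in> carrier G" "s \<in> S"
  shows "dst p (x \<otimes> s) \<le> dst p x + 1" "dst p x \<le> dst p (x \<otimes> s) + 1"
  using dst_triangle[of p x "x \<otimes> s"] dst_triangle[of p "x \<otimes> s" x] dst_step[of s x]
    dst_commute[of x "x \<otimes> s"] assms by auto

lemma dst_mult_right:
  assumes "x \<in> carrier G" "g \<in> carrier G"
  shows "dst x (x \<otimes> g) = dst \<one> g"
  using dst_mult_left[of x \<one> g] assms by simp

lemma predecessor:
  assumes "p \<in> carrier G" "x \<in> carrier G" "dst p x = Suc n"
  obtains y s where "y \<in> carrier G" "s \<in> S" "x = y \<otimes> s" "dst p y \<le> n"
proof -
  obtain ss where ss: "length ss = Suc n" "set ss \<subseteq> S" "x = foldl (\<otimes>) p ss"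
    by (rule geodesic[OF assms(1,2)]) (use assms(3) in simp)
  then obtain ts s where ts: "ss = ts @ [s]" by (metis append_butlast_last_id length_0_conv nat.distinct(1))
  show ?thesis
  proof (rule that[of "foldl (\<otimes>) p ts" s])
    show "dst p (foldl (\<otimes>) p ts) \<le> n" using dst_le[of ts p] ss ts by simp
  qed (use foldl_closed ss ts assms in auto)
qed

section \<open>Balls and their volume\<close>

lemma mem_wball: "p \<in> carrier G \<Longrightarrow> x \<in> wball p n \<longleftrightarrow> x \<in> carrier G \<and> dst p x \<le> n"
  by (auto simp: word_ball_def dst_commute)

lemma wball_carrier: "x \<in> wball p n \<Longrightarrow> x \<in> carrier G"
  by (simp add: word_ball_def)

lemma wball_mono: "m \<le> n \<Longrightarrow> wball p m \<subseteq> wball p n"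
  by (auto simp: word_ball_def)

lemma finite_wball:
  assumes "p \<in> carrier G"
  shows "finite (wball p n)"
proof -
  have "wball p n \<subseteq> (\<lambda>ss. foldl (\<otimes>) p ss) ` {ss. set ss \<subseteq> S \<and> length ss \<le> n}"
  proof
    fix x assume "x \<in> wball p n"
    then have x: "x \<in> carrier G" "dst p x \<le> n" using mem_wball assms by auto
    obtain ss where "length ss = dst p x" "set ss \<subseteq> S" "x = foldl (\<otimes>) p ss"
      by (rule geodesic[OF assms x(1)])
    then show "x \<in> (\<lambda>ss. foldl (\<otimes>) p ss) ` {ss. set ss \<subseteq> S \<and> length ss \<le> n}"
      using x by auto
  qed
  then show ?thesis
    using finite_lists_length_le[OF finite_S] finite_subset by blast
qed

text \<open>Left translation by \<open>p\<close> is an isometry, so volumes do not depend on the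
  centre.\<close>

lemma card_wball:
  assumes p: "p \<in> carrier G"
  shows "card (wball p n) = growth G S n"
proof -
  have "bij_betw (\<lambda>x. p \<otimes> x) (wball \<one> n) (wball p n)"
  proof (rule bij_betw_byWitness[where f' = "\<lambda>x. inv p \<otimes> x"])
    show "(\<lambda>x. p \<otimes> x) ` wball \<one> n \<subseteq> wball p n"
      using dst_mult_right[OF p] p by (auto simp: mem_wball)
    show "(\<lambda>x. inv p \<otimes> x) ` wball p n \<subseteq> wball \<one> n"
    proof (rule image_subsetI)
      fix x assume "x \<in> wball p n"
      then show "inv p \<otimes> x \<in> wball \<one> n"
        using dst_mult_right[OF p, of "inv p \<otimes> x"] p by (auto simp: mem_wball mult_inv_cancel)
    qed
  qed (use p wball_carrier in \<open>auto simp: m_assoc[symmetric]\<close>)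
  then show ?thesis by (simp add: growth_def bij_betw_same_card)
qed

section \<open>Discrete gradient, Laplacian and harmonic functions\<close>

definition grad_sq :: "('a \<Rightarrow> real) \<Rightarrow> 'a \<Rightarrow> real" where
  "grad_sq u x = (\<Sum>s\<in>S. (u (x \<otimes> s) - u x)\<^sup>2)"

lemma grad_sq_nonneg: "grad_sq u x \<ge> 0"
  by (simp add: grad_sq_def sum_nonneg)

text \<open>Symmetry of \<open>S\<close> turns the neighbours into the points
  \<open>x \<otimes> s\<close>, and cancellation makes these distinct, so the sum over a set of
  points becomes a sum over \<open>S\<close>.\<close>

lemma laplacian_eq:
  assumes "x \<in> carrier G"
  shows "laplacian G S u x = (\<Sum>s\<in>S. u (x \<otimes> s) - u x)"
proof -
  have "{y \<in> carrier G. \<exists>s\<in>S. x = y \<otimes> s} = (\<lambda>s. x \<otimes> s) ` S"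
  proof (intro equalityI subsetI)
    fix y assume "y \<in> {y \<in> carrier G. \<exists>s\<in>S. x = y \<otimes> s}"
    then obtain s where "y \<in> carrier G" "s \<in> S" "x = y \<otimes> s" by blast
    then have "inv s \<in> S" "y = x \<otimes> inv s" using S_inv by (auto simp: m_assoc)
    then show "y \<in> (\<lambda>s. x \<otimes> s) ` S" by blast
  next
    fix y assume "y \<in> (\<lambda>s. x \<otimes> s) ` S"
    then obtain s where "s \<in> S" "y = x \<otimes> s" by blast
    then show "y \<in> {y \<in> carrier G. \<exists>s\<in>S. x = y \<otimes> s}"
      using assms S_inv[of s] by (auto simp: m_assoc intro!: bexI[of _ "inv s"])
  qed
  moreover have "inj_on (\<lambda>s. x \<otimes> s) S"
    using assms by (auto simp: inj_on_def)
  ultimately show ?thesis by (simp add: laplacian_def sum.reindex)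
qed

text \<open>Vanishing outside the carrier makes a function determined by its values on the group, so
  linear independence in the full function type is the intended one.\<close>

definition harmonic :: "('a \<Rightarrow> real) \<Rightarrow> bool" where
  "harmonic u \<longleftrightarrow> (\<forall>x. x \<notin> carrier G \<longrightarrow> u x = 0) \<and> (\<forall>x\<in>carrier G. (\<Sum>s\<in>S. u (x \<otimes> s) - u x) = 0)"

lemma harmonic_span:
  assumes "\<And>v. v \<in> B \<Longrightarrow> harmonic v" "u \<in> fs.span B"
  shows "harmonic u"
proof -
  have "fs.subspace {u. harmonic u}"
  proof (rule fs.subspaceI)
    show "0 \<in> {u. harmonic u}" by (simp add: harmonic_def)
  next
    fix u v assume "u \<in> {u. harmonic u}" "v \<in> {u. harmonic u}"
    then show "u + v \<in> {u. harmonic u}"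
      by (auto simp: harmonic_def sum_subtractf sum.distrib algebra_simps)
  next
    fix c u assume "u \<in> {u. harmonic u}"
    moreover have "(\<Sum>s\<in>S. fscale c u (x \<otimes> s) - fscale c u x) = c * (\<Sum>s\<in>S. u (x \<otimes> s) - u x)" for x
      by (simp add: fscale_apply sum_distrib_left algebra_simps)
    ultimately show "fscale c u \<in> {u. harmonic u}"
      by (auto simp: harmonic_def fscale_apply)
  qed
  moreover have "B \<subseteq> {u. harmonic u}" using assms(1) by blast
  ultimately show ?thesis using fs.span_minimal assms(2) by blast
qed

section \<open>The Poincare inequality\<close>

lemma sum_translate_le:
  assumes "finite B'" "g \<in> carrier G" "B \<subseteq> carrier G" "(\<lambda>x. x \<otimes> g) ` B \<subseteq> B'"
    and "\<And>y. f y \<ge> (0::real)"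
  shows "(\<Sum>x\<in>B. f (x \<otimes> g)) \<le> sum f B'"
proof -
  have "inj_on (\<lambda>x. x \<otimes> g) B"
    using assms by (auto simp: inj_on_def subset_iff)
  then have "(\<Sum>x\<in>B. f (x \<otimes> g)) = sum f ((\<lambda>x. x \<otimes> g) ` B)"
    by (simp add: sum.reindex)
  also have "\<dots> \<le> sum f B'" using assms by (intro sum_mono2) auto
  finally show ?thesis .
qed

text \<open>The word is walked along one letter at a time. Right translation need not be an
  isometry, but it moves each point by at most the length of the word, so the gradient is summed
  over a slightly larger ball.\<close>

lemma sum_translate_diff_le:
  assumes x0: "x0 \<in> carrier G" and "set ss \<subseteq> S"
  shows "(\<Sum>x\<in>wball x0 r. (f (foldl (\<otimes>) x ss) - f x)\<^sup>2)
    \<le> (real (length ss))\<^sup>2 * (\<Sum>x\<in>wball x0 (r + length ss). grad_sq f x)"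
  using assms(2)
proof (induction ss rule: rev_induct)
  case (snoc s ss)
  define m where "m = length ss"
  define z where "z = (\<lambda>x. foldl (\<otimes>) x ss)"
  define E where "E = (\<lambda>k. \<Sum>x\<in>wball x0 k. grad_sq f x)"
  have Emono: "E k \<le> E l" if "k \<le> l" for k l
    unfolding E_def using that by (intro sum_mono2) (auto simp: finite_wball x0 grad_sq_nonneg dest: wball_mono)
  have s: "s \<in> S" "set ss \<subseteq> S" using snoc.prems by auto
  have IH: "(\<Sum>x\<in>wball x0 r. (f (z x) - f x)\<^sup>2) \<le> (real m)\<^sup>2 * E (r + m)"
    using snoc.IH[OF s(2)] by (simp add: m_def z_def E_def)
  define g where "g = foldl (\<otimes>) \<one> ss"
  have g: "g \<in> carrier G" unfolding g_def using s by (intro foldl_closed) auto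
  have z: "z x = x \<otimes> g" if "x \<in> carrier G" for x
    using foldl_mult[of x \<one> ss] s that by (simp add: z_def g_def)
  have "(\<lambda>x. x \<otimes> g) ` wball x0 r \<subseteq> wball x0 (r + m)"
  proof
    fix y assume "y \<in> (\<lambda>x. x \<otimes> g) ` wball x0 r"
    then obtain x where x: "x \<in> carrier G" "dst x0 x \<le> r" "y = x \<otimes> g" using mem_wball x0 by auto
    moreover have "dst x y \<le> m" using dst_le[OF s(2), of x] z x by (simp add: z_def m_def)
    ultimately show "y \<in> wball x0 (r + m)"
      using dst_triangle[of x0 x y] x0 g by (simp add: mem_wball)
  qed
  then have "(\<Sum>x\<in>wball x0 r. grad_sq f (x \<otimes> g)) \<le> E (r + m)"
    unfolding E_def using g by (intro sum_translate_le) (auto simp: finite_wball x0 grad_sq_nonneg wball_carrier)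
  moreover have "(\<Sum>x\<in>wball x0 r. (f (z x \<otimes> s) - f (z x))\<^sup>2) \<le> (\<Sum>x\<in>wball x0 r. grad_sq f (x \<otimes> g))"
  proof (rule sum_mono)
    fix x assume "x \<in> wball x0 r"
    then have "z x = x \<otimes> g" using z wball_carrier by blast
    then show "(f (z x \<otimes> s) - f (z x))\<^sup>2 \<le> grad_sq f (x \<otimes> g)"
      unfolding grad_sq_def using finite_S s by (auto intro!: member_le_sum)
  qed
  ultimately have last: "(\<Sum>x\<in>wball x0 r. (f (z x \<otimes> s) - f (z x))\<^sup>2) \<le> E (r + m)" by linarith
  have "(\<Sum>x\<in>wball x0 r. (f (z x \<otimes> s) - f x)\<^sup>2) \<le> (real (Suc m))\<^sup>2 * E (r + m)"
  proof (cases "m = 0")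
    case True
    then show ?thesis using last by (simp add: z_def m_def)
  next
    case False
    \<comment> \<open>The weights satisfy \<open>(1 + 1 / m) * m^2 + (1 + m) = (m + 1)^2\<close>, so
      the constant stays exactly quadratic in the length.\<close>
    have "(a + b)\<^sup>2 \<le> (1 + 1 / real m) * a\<^sup>2 + (1 + real m) * b\<^sup>2" for a b :: real
    proof -
      have "0 \<le> (a - real m * b)\<^sup>2 / real m" by simp
      also have "\<dots> = (1 + 1 / real m) * a\<^sup>2 + (1 + real m) * b\<^sup>2 - (a + b)\<^sup>2"
        using False by (simp add: power2_eq_square field_simps)
      finally show ?thesis by simp
    qed
    from this[of "f (z x) - f x" "f (z x \<otimes> s) - f (z x)" for x]
    have "(f (z x \<otimes> s) - f x)\<^sup>2 \<le> (1 + 1 / real m) * (f (z x) - f x)\<^sup>2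
        + (1 + real m) * (f (z x \<otimes> s) - f (z x))\<^sup>2" for x
      by simp
    then have "(\<Sum>x\<in>wball x0 r. (f (z x \<otimes> s) - f x)\<^sup>2)
      \<le> (\<Sum>x\<in>wball x0 r. (1 + 1 / real m) * (f (z x) - f x)\<^sup>2 + (1 + real m) * (f (z x \<otimes> s) - f (z x))\<^sup>2)"
      by (rule sum_mono)
    also have "\<dots> = (1 + 1 / real m) * (\<Sum>x\<in>wball x0 r. (f (z x) - f x)\<^sup>2)
      + (1 + real m) * (\<Sum>x\<in>wball x0 r. (f (z x \<otimes> s) - f (z x))\<^sup>2)"
      by (simp add: sum.distrib sum_distrib_left)
    also have "\<dots> \<le> (1 + 1 / real m) * ((real m)\<^sup>2 * E (r + m)) + (1 + real m) * E (r + m)"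
      using IH last by (intro add_mono mult_left_mono) auto
    also have "\<dots> = (real (Suc m))\<^sup>2 * E (r + m)"
      using False by (simp add: power2_eq_square field_simps)
    finally show ?thesis .
  qed
  also have "\<dots> \<le> (real (Suc m))\<^sup>2 * E (r + Suc m)"
    by (intro mult_left_mono Emono) auto
  finally show ?case by (simp add: z_def m_def E_def)
qed simp

text \<open>The zero mean replaces squares by differences over pairs of points of the ball. Writing
  \<open>y = x \<otimes> g\<close> with \<open>g\<close> of length at most \<open>2 * r\<close>, one
  word for \<open>g\<close> serves all \<open>x\<close> at once, and
  \<open>sum_translate_diff_le\<close> bounds each translation.\<close>

lemma poincare:
  assumes x0: "x0 \<in> carrier G" and mean: "sum f (wball x0 r) = 0"
  shows "real (growth G S r) * (\<Sum>x\<in>wball x0 r. (f x)\<^sup>2)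
    \<le> real (growth G S (2 * r)) * ((2 * real r)\<^sup>2 * (\<Sum>x\<in>wball x0 (3 * r). grad_sq f x))"
proof -
  let ?B = "wball x0 r"
  let ?E = "\<lambda>k. \<Sum>x\<in>wball x0 k. grad_sq f x"
  have "(\<Sum>y\<in>?B. (f y - f x)\<^sup>2) \<le> (\<Sum>g\<in>wball \<one> (2 * r). (f (x \<otimes> g) - f x)\<^sup>2)" if x: "x \<in> ?B" for x
  proof -
    have xc: "x \<in> carrier G" using x wball_carrier by blast
    have inj: "inj_on (\<lambda>y. inv x \<otimes> y) ?B"
      using xc wball_carrier by (auto simp: inj_on_def)
    have "(\<Sum>y\<in>?B. (f y - f x)\<^sup>2) = (\<Sum>y\<in>?B. (f (x \<otimes> (inv x \<otimes> y)) - f x)\<^sup>2)"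
      using xc wball_carrier by (intro sum.cong) (auto simp: m_assoc[symmetric])
    also have "\<dots> = (\<Sum>g\<in>(\<lambda>y. inv x \<otimes> y) ` ?B. (f (x \<otimes> g) - f x)\<^sup>2)"
      using inj by (simp add: sum.reindex)
    also have "\<dots> \<le> (\<Sum>g\<in>wball \<one> (2 * r). (f (x \<otimes> g) - f x)\<^sup>2)"
    proof (rule sum_mono2)
      show "(\<lambda>y. inv x \<otimes> y) ` ?B \<subseteq> wball \<one> (2 * r)"
      proof (rule image_subsetI)
        fix y assume "y \<in> ?B"
        then have y: "y \<in> carrier G" "dst x0 y \<le> r" using mem_wball x0 by auto
        have "dst \<one> (inv x \<otimes> y) = dst x y"
          using dst_mult_right[of x "inv x \<otimes> y"] xc y by (simp add: m_assoc[symmetric])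
        also have "\<dots> \<le> 2 * r"
          using dst_triangle[of x x0 y] dst_commute[of x x0] x xc y x0 mem_wball by auto
        finally show "inv x \<otimes> y \<in> wball \<one> (2 * r)" using xc y by (simp add: mem_wball)
      qed
    qed (auto simp: finite_wball)
    finally show ?thesis .
  qed
  then have "(\<Sum>x\<in>?B. \<Sum>y\<in>?B. (f y - f x)\<^sup>2) \<le> (\<Sum>x\<in>?B. \<Sum>g\<in>wball \<one> (2 * r). (f (x \<otimes> g) - f x)\<^sup>2)"
    by (rule sum_mono)
  also have "\<dots> = (\<Sum>g\<in>wball \<one> (2 * r). \<Sum>x\<in>?B. (f (x \<otimes> g) - f x)\<^sup>2)"
    by (rule sum.swap)
  also have "\<dots> \<le> (\<Sum>g\<in>wball \<one> (2 * r). (2 * real r)\<^sup>2 * ?E (3 * r))"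
  proof (rule sum_mono)
    fix g assume "g \<in> wball \<one> (2 * r)"
    then have g: "g \<in> carrier G" "dst \<one> g \<le> 2 * r" using mem_wball by auto
    obtain ss where ss: "length ss = dst \<one> g" "set ss \<subseteq> S" "g = foldl (\<otimes>) \<one> ss"
      by (rule geodesic[OF one_closed g(1)])
    have "foldl (\<otimes>) x ss = x \<otimes> g" if "x \<in> ?B" for x
      using foldl_mult[OF wball_carrier[OF that] one_closed ss(2)] wball_carrier[OF that]
      by (simp add: ss(3)[symmetric])
    then have "(\<Sum>x\<in>?B. (f (x \<otimes> g) - f x)\<^sup>2) = (\<Sum>x\<in>?B. (f (foldl (\<otimes>) x ss) - f x)\<^sup>2)"
      by simp
    also have "\<dots> \<le> (real (length ss))\<^sup>2 * ?E (r + length ss)"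
      by (rule sum_translate_diff_le[OF x0 ss(2)])
    also have "\<dots> \<le> (2 * real r)\<^sup>2 * ?E (3 * r)"
    proof (rule mult_mono)
      have "real (length ss) \<le> 2 * real r" using g ss by linarith
      then show "(real (length ss))\<^sup>2 \<le> (2 * real r)\<^sup>2" by (rule power_mono) simp
      have "wball x0 (r + length ss) \<subseteq> wball x0 (3 * r)" using g ss by (intro wball_mono) auto
      then show "?E (r + length ss) \<le> ?E (3 * r)"
        by (intro sum_mono2) (auto simp: finite_wball x0 grad_sq_nonneg)
    qed (auto simp: sum_nonneg grad_sq_nonneg)
    finally show "(\<Sum>x\<in>?B. (f (x \<otimes> g) - f x)\<^sup>2) \<le> (2 * real r)\<^sup>2 * ?E (3 * r)" .
  qed
  also have "\<dots> = real (growth G S (2 * r)) * ((2 * real r)\<^sup>2 * ?E (3 * r))"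
    by (simp add: growth_def)
  finally have "2 * (real (growth G S r) * (\<Sum>x\<in>?B. (f x)\<^sup>2))
      \<le> real (growth G S (2 * r)) * ((2 * real r)\<^sup>2 * ?E (3 * r))"
    using mean by (simp add: sum_sq_pairs card_wball[OF x0])
  moreover have "0 \<le> real (growth G S r) * (\<Sum>x\<in>?B. (f x)\<^sup>2)"
    by (intro mult_nonneg_nonneg sum_nonneg) auto
  ultimately show ?thesis by linarith
qed

section \<open>Summation by parts and Caccioppoli's inequality\<close>

definition edges :: "'a set \<Rightarrow> ('a \<times> 'a) set" where
  "edges B = {(x, s). x \<in> carrier G \<and> s \<in> S \<and> (x \<in> B \<or> x \<otimes> s \<in> B)}"

lemma finite_edges:
  assumes "finite B"
  shows "finite (edges B)"
proof -
  have "edges B \<subseteq> B \<times> S \<union> (\<lambda>(y, s). (y \<otimes> inv s, s)) ` (B \<times> S)"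
  proof
    fix e assume "e \<in> edges B"
    then obtain x s where e: "e = (x, s)" "x \<in> carrier G" "s \<in> S" "x \<in> B \<or> x \<otimes> s \<in> B"
      by (auto simp: edges_def)
    moreover have "x = (x \<otimes> s) \<otimes> inv s" using e by (simp add: m_assoc)
    ultimately show "e \<in> B \<times> S \<union> (\<lambda>(y, s). (y \<otimes> inv s, s)) ` (B \<times> S)" by force
  qed
  then show ?thesis
    using assms finite_S by (meson finite_SigmaI finite_UnI finite_imageI finite_subset)
qed

text \<open>Reversing an edge, \<open>(x, s)\<close> to \<open>(x \<otimes> s, inv s)\<close>, is an
  involution of \<open>edges B\<close>; summation by parts becomes a relabelling.\<close>

lemma sum_edges_swap:
  "(\<Sum>(x, s)\<in>edges B. h x (x \<otimes> s)) = (\<Sum>(x, s)\<in>edges B. h (x \<otimes> s) x)"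
proof -
  have *: "(x \<otimes> s, inv s) \<in> edges B" "x \<otimes> s \<otimes> inv s = x" "inv (inv s) = s" if "(x, s) \<in> edges B" for x s
    using that S_inv by (auto simp: edges_def m_assoc)
  show ?thesis
    by (rule sum.reindex_bij_witness[where i = "\<lambda>(x, s). (x \<otimes> s, inv s)" and j = "\<lambda>(x, s). (x \<otimes> s, inv s)"])
      (use * in auto)
qed

lemma sum_edges_supported:
  assumes "finite B" "B \<subseteq> carrier G" "\<And>x s. x \<in> carrier G \<Longrightarrow> x \<notin> B \<Longrightarrow> h x s = (0::real)"
  shows "(\<Sum>(x, s)\<in>edges B. h x s) = (\<Sum>x\<in>B. \<Sum>s\<in>S. h x s)"
proof -
  have "(\<Sum>(x, s)\<in>edges B. h x s) = (\<Sum>(x, s)\<in>B \<times> S. h x s)"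
    using assms by (intro sum.mono_neutral_right finite_edges) (auto simp: edges_def)
  then show ?thesis by (simp add: sum.cartesian_product)
qed

text \<open>Green's formula applied to \<open>\<phi>\<^sup>2 u\<close>.\<close>
lemma energy_identity:
  assumes B: "finite B" "B \<subseteq> carrier G" and u: "harmonic u"
    and \<phi>: "\<And>x. x \<in> carrier G \<Longrightarrow> x \<notin> B \<Longrightarrow> \<phi> x = 0"
  shows "(\<Sum>(x, s)\<in>edges B. (\<phi> x)\<^sup>2 * (u (x \<otimes> s) - u x)\<^sup>2)
    = (\<Sum>(x, s)\<in>edges B. ((\<phi> x)\<^sup>2 - (\<phi> (x \<otimes> s))\<^sup>2) * u (x \<otimes> s) * (u (x \<otimes> s) - u x))"
proof -
  let ?a = "\<lambda>x y. (\<phi> x)\<^sup>2 * u x * (u y - u x)"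
  have a0: "(\<Sum>(x, s)\<in>edges B. ?a x (x \<otimes> s)) = 0"
  proof -
    have "(\<Sum>(x, s)\<in>edges B. ?a x (x \<otimes> s)) = (\<Sum>x\<in>B. \<Sum>s\<in>S. ?a x (x \<otimes> s))"
      using \<phi> by (intro sum_edges_supported[OF B]) auto
    also have "\<dots> = (\<Sum>x\<in>B. (\<phi> x)\<^sup>2 * u x * (\<Sum>s\<in>S. u (x \<otimes> s) - u x))"
      by (simp only: sum_distrib_left)
    also have "\<dots> = 0" using u B(2) by (intro sum.neutral) (auto simp: harmonic_def)
    finally show ?thesis .
  qed
  then have b0: "(\<Sum>(x, s)\<in>edges B. ?a (x \<otimes> s) x) = 0"
    using sum_edges_swap[of ?a B] by simp
  \<comment> \<open>Edge by edge, the difference of the two summands is minus the flux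
    \<open>?a\<close> in both orientations, and each flux sum vanishes by harmonicity.\<close>
  have "(\<Sum>(x, s)\<in>edges B. (\<phi> x)\<^sup>2 * (u (x \<otimes> s) - u x)\<^sup>2)
      - (\<Sum>(x, s)\<in>edges B. ((\<phi> x)\<^sup>2 - (\<phi> (x \<otimes> s))\<^sup>2) * u (x \<otimes> s) * (u (x \<otimes> s) - u x))
      = - (\<Sum>(x, s)\<in>edges B. ?a x (x \<otimes> s)) - (\<Sum>(x, s)\<in>edges B. ?a (x \<otimes> s) x)"
    unfolding sum_subtractf[symmetric] sum_negf[symmetric]
    by (intro sum.cong) (auto simp: power2_eq_square algebra_simps)
  then show ?thesis using a0 b0 by simp
qed

text \<open>The cutoff is the depth \<open>R - dst p x\<close>, which is 1-Lipschitz and, by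
  truncated subtraction, zero outside the ball. The cross terms of \<open>energy_identity\<close>
  are split so that half of the energy can be absorbed.\<close>

lemma caccioppoli:
  assumes p: "p \<in> carrier G" and u: "harmonic u"
  shows "(\<Sum>x\<in>wball p R. (real (R - dst p x))\<^sup>2 * grad_sq u x) \<le> 4 * real (card S) * (\<Sum>x\<in>wball p R. (u x)\<^sup>2)"
proof -
  let ?B = "wball p R"
  define \<phi> where "\<phi> = (\<lambda>x. real (R - dst p x))"
  define w where "w = (\<lambda>y. if y \<in> ?B then (u y)\<^sup>2 else 0)"
  have B: "finite ?B" "?B \<subseteq> carrier G" using finite_wball p wball_carrier by auto
  have \<phi>0: "\<phi> x = 0" if "x \<in> carrier G" "x \<notin> ?B" for x
    using that p by (auto simp: \<phi>_def mem_wball)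
  define T where "T = (\<Sum>(x, s)\<in>edges ?B. (\<phi> x)\<^sup>2 * (u (x \<otimes> s) - u x)\<^sup>2)"
  have T: "T = (\<Sum>x\<in>?B. (\<phi> x)\<^sup>2 * grad_sq u x)"
    unfolding T_def grad_sq_def sum_distrib_left using \<phi>0 by (intro sum_edges_supported[OF B]) auto
  have T': "(\<Sum>(x, s)\<in>edges ?B. (\<phi> (x \<otimes> s))\<^sup>2 * (u (x \<otimes> s) - u x)\<^sup>2) = T"
    using sum_edges_swap[of "\<lambda>x y. (\<phi> x)\<^sup>2 * (u y - u x)\<^sup>2" ?B]
    by (simp add: T_def power2_commute)
  have W: "(\<Sum>(x, s)\<in>edges ?B. w (x \<otimes> s)) = real (card S) * (\<Sum>x\<in>?B. (u x)\<^sup>2)"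
  proof -
    have "(\<Sum>(x, s)\<in>edges ?B. w (x \<otimes> s)) = (\<Sum>(x, s)\<in>edges ?B. w x)"
      using sum_edges_swap[of "\<lambda>x y. w x" ?B] by simp
    also have "\<dots> = (\<Sum>x\<in>?B. \<Sum>s\<in>S. w x)"
      by (intro sum_edges_supported[OF B]) (auto simp: w_def)
    also have "\<dots> = real (card S) * (\<Sum>x\<in>?B. (u x)\<^sup>2)"
      by (simp add: w_def sum_distrib_left)
    finally show ?thesis .
  qed
  have "T = (\<Sum>(x, s)\<in>edges ?B. ((\<phi> x)\<^sup>2 - (\<phi> (x \<otimes> s))\<^sup>2) * u (x \<otimes> s) * (u (x \<otimes> s) - u x))"
    unfolding T_def by (rule energy_identity[OF B u]) (use \<phi>0 in auto)
  also have "\<dots> \<le> (\<Sum>(x, s)\<in>edges ?B. 1 / 4 * ((\<phi> x)\<^sup>2 * (u (x \<otimes> s) - u x)\<^sup>2)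
      + 1 / 4 * ((\<phi> (x \<otimes> s))\<^sup>2 * (u (x \<otimes> s) - u x)\<^sup>2) + 2 * w (x \<otimes> s))"
  proof (rule sum_mono, clarify)
    fix x s assume "(x, s) \<in> edges ?B"
    then have x: "x \<in> carrier G" "s \<in> S" by (auto simp: edges_def)
    define y where "y = x \<otimes> s"
    define t where "t = u y - u x"
    have y: "y \<in> carrier G" using x by (simp add: y_def)
    have d: "dst p y \<le> dst p x + 1" "dst p x \<le> dst p y + 1"
      using dst_step'[OF p x] by (auto simp: y_def)
    then have lip: "\<bar>\<phi> x - \<phi> y\<bar> \<le> 1" by (auto simp: \<phi>_def)
    have nn: "\<phi> x \<ge> 0" "\<phi> y \<ge> 0" by (auto simp: \<phi>_def)
    \<comment> \<open>A positive cutoff value at \<open>x\<close> or at \<open>y\<close> puts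
      \<open>y\<close> into the ball, because positive depth means distance less than
      \<open>R\<close> and an edge adds at most 1. Hence no larger ball appears on the
      right.\<close>
    have prod: "c * (\<bar>u y\<bar> * \<bar>t\<bar>) \<le> 1 / 4 * (c\<^sup>2 * t\<^sup>2) + w y" if "c \<ge> 0" "c > 0 \<Longrightarrow> y \<in> ?B" for c
    proof (cases "c > 0")
      case True
      have "0 \<le> (1 / 2 * (c * \<bar>t\<bar>) - \<bar>u y\<bar>)\<^sup>2" by simp
      also have "\<dots> = 1 / 4 * (c\<^sup>2 * t\<^sup>2) + (u y)\<^sup>2 - c * (\<bar>u y\<bar> * \<bar>t\<bar>)"
        by (simp add: power2_diff power_mult_distrib power_divide)
      finally show ?thesis using that True by (simp add: w_def)
    next
      case False
      then have "c = 0" using that by simp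
      then show ?thesis by (simp add: w_def)
    qed
    have "((\<phi> x)\<^sup>2 - (\<phi> y)\<^sup>2) * u y * t \<le> \<bar>((\<phi> x)\<^sup>2 - (\<phi> y)\<^sup>2) * u y * t\<bar>" by simp
    also have "\<dots> = \<bar>\<phi> x - \<phi> y\<bar> * ((\<phi> x + \<phi> y) * (\<bar>u y\<bar> * \<bar>t\<bar>))"
      using nn by (simp add: power2_eq_square square_diff_square_factored abs_mult)
    also have "\<dots> \<le> 1 * ((\<phi> x + \<phi> y) * (\<bar>u y\<bar> * \<bar>t\<bar>))"
      using lip nn by (intro mult_right_mono) auto
    also have "\<dots> = \<phi> x * (\<bar>u y\<bar> * \<bar>t\<bar>) + \<phi> y * (\<bar>u y\<bar> * \<bar>t\<bar>)" by (simp add: algebra_simps)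
    also have "\<dots> \<le> (1 / 4 * ((\<phi> x)\<^sup>2 * t\<^sup>2) + w y) + (1 / 4 * ((\<phi> y)\<^sup>2 * t\<^sup>2) + w y)"
      using d nn y p by (intro add_mono prod) (auto simp: \<phi>_def mem_wball)
    finally show "((\<phi> x)\<^sup>2 - (\<phi> (x \<otimes> s))\<^sup>2) * u (x \<otimes> s) * (u (x \<otimes> s) - u x)
      \<le> 1 / 4 * ((\<phi> x)\<^sup>2 * (u (x \<otimes> s) - u x)\<^sup>2)
      + 1 / 4 * ((\<phi> (x \<otimes> s))\<^sup>2 * (u (x \<otimes> s) - u x)\<^sup>2) + 2 * w (x \<otimes> s)"
      by (simp add: t_def y_def)
  qed
  \<comment> \<open>Edge reversal turns the second energy sum into \<open>T\<close> too, so half of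
    \<open>T\<close> stands on the right and is absorbed.\<close>
  also have "\<dots> = 1 / 4 * T + 1 / 4 * T + 2 * (real (card S) * (\<Sum>x\<in>?B. (u x)\<^sup>2))"
    unfolding W[symmetric]
    by (subst (2) T'[symmetric]) (simp add: T_def sum.distrib sum_distrib_left case_prod_unfold)
  finally have "T \<le> 4 * (real (card S) * (\<Sum>x\<in>?B. (u x)\<^sup>2))" by linarith
  then show ?thesis by (simp add: T \<phi>_def)
qed

text \<open>Test \<open>energy_identity\<close> with the indicator of the ball of radius
  \<open>n\<close>: only boundary edges contribute, and \<open>u\<close> is zero at their outer end,
  so the energy is at most 0 and \<open>u\<close> is constant along edges. The value at
  \<open>p\<close> matters when the sphere is empty, where nonzero constants satisfy the
  rest.\<close>

lemma harmonic_vanishes_on_ball: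
  assumes p: "p \<in> carrier G" and u: "harmonic u"
    and sphere: "\<And>x. x \<in> carrier G \<Longrightarrow> dst p x = Suc n \<Longrightarrow> u x = 0" and "u p = 0"
  shows "x \<in> wball p (Suc n) \<Longrightarrow> u x = 0"
proof -
  let ?B = "wball p n"
  define \<phi> where "\<phi> = (\<lambda>x. if x \<in> ?B then 1 else (0::real))"
  have B: "finite ?B" "?B \<subseteq> carrier G" using finite_wball p wball_carrier by auto
  have "(\<Sum>(x, s)\<in>edges ?B. (\<phi> x)\<^sup>2 * (u (x \<otimes> s) - u x)\<^sup>2)
    = (\<Sum>(x, s)\<in>edges ?B. ((\<phi> x)\<^sup>2 - (\<phi> (x \<otimes> s))\<^sup>2) * u (x \<otimes> s) * (u (x \<otimes> s) - u x))"
    by (rule energy_identity[OF B u]) (auto simp: \<phi>_def)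
  also have "\<dots> \<le> 0"
  proof (rule sum_nonpos, clarify)
    fix x s assume "(x, s) \<in> edges ?B"
    then have x: "x \<in> carrier G" "s \<in> S" by (auto simp: edges_def)
    have "u x = 0" if "x \<notin> ?B" "x \<otimes> s \<in> ?B"
      using dst_step'[OF p x] that x p by (intro sphere) (auto simp: mem_wball)
    moreover have "u (x \<otimes> s) = 0" if "x \<in> ?B" "x \<otimes> s \<notin> ?B"
      using dst_step'[OF p x] that x p by (intro sphere) (auto simp: mem_wball)
    ultimately show "((\<phi> x)\<^sup>2 - (\<phi> (x \<otimes> s))\<^sup>2) * u (x \<otimes> s) * (u (x \<otimes> s) - u x) \<le> 0"
      by (auto simp: \<phi>_def)
  qed
  finally have le: "(\<Sum>x\<in>?B. \<Sum>s\<in>S. (\<phi> x)\<^sup>2 * (u (x \<otimes> s) - u x)\<^sup>2) \<le> 0"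
    by (subst (asm) sum_edges_supported[OF B]) (auto simp: \<phi>_def)
  have step: "u (x \<otimes> s) = u x" if "x \<in> ?B" "s \<in> S" for x s
  proof -
    have "(\<phi> x)\<^sup>2 * (u (x \<otimes> s) - u x)\<^sup>2 \<le> (\<Sum>s\<in>S. (\<phi> x)\<^sup>2 * (u (x \<otimes> s) - u x)\<^sup>2)"
      using that finite_S by (intro member_le_sum[of s S "\<lambda>s. (\<phi> x)\<^sup>2 * (u (x \<otimes> s) - u x)\<^sup>2"]) auto
    also have "\<dots> \<le> (\<Sum>x\<in>?B. \<Sum>s\<in>S. (\<phi> x)\<^sup>2 * (u (x \<otimes> s) - u x)\<^sup>2)"
      using that B by (intro member_le_sum[of x ?B "\<lambda>x. \<Sum>s\<in>S. (\<phi> x)\<^sup>2 * (u (x \<otimes> s) - u x)\<^sup>2"]) (auto intro: sum_nonneg)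
    finally have "(\<phi> x)\<^sup>2 * (u (x \<otimes> s) - u x)\<^sup>2 \<le> 0" using le by linarith
    then show ?thesis using that by (simp add: \<phi>_def)
  qed
  have "x \<in> carrier G \<Longrightarrow> dst p x \<le> Suc n \<Longrightarrow> u x = 0" for x
  proof (induction "dst p x" arbitrary: x)
    case 0
    then show ?case using dst_eq_0[OF p] \<open>u p = 0\<close> by metis
  next
    case (Suc k)
    obtain y s where y: "y \<in> carrier G" "s \<in> S" "x = y \<otimes> s" "dst p y \<le> k"
      using predecessor[OF p] Suc.prems Suc.hyps(2) by metis
    moreover have "dst p y = k" using y dst_step'(1)[OF p y(1,2)] Suc.hyps(2) by auto
    ultimately have "u y = 0" using Suc by auto
    moreover have "y \<in> ?B" using y Suc p by (auto simp: mem_wball)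
    ultimately show ?case using step y by auto
  qed
  then show "x \<in> wball p (Suc n) \<Longrightarrow> u x = 0" using p by (simp add: mem_wball)
qed

section \<open>Separated sets and packing\<close>

lemma exists_maximal_separated:
  assumes "finite L" "L \<subseteq> carrier G"
  shows "\<exists>Y. Y \<subseteq> L \<and> (\<forall>x\<in>Y. \<forall>y\<in>Y. x \<noteq> y \<longrightarrow> k < dst x y) \<and> (\<forall>y\<in>L. \<exists>x\<in>Y. dst x y \<le> k)"
  using assms
proof (induction L)
  case (insert a L)
  then obtain Y where Y: "Y \<subseteq> L" "\<forall>x\<in>Y. \<forall>y\<in>Y. x \<noteq> y \<longrightarrow> k < dst x y" "\<forall>y\<in>L. \<exists>x\<in>Y. dst x y \<le> k"
    by auto
  show ?case
  proof (cases "\<exists>x\<in>Y. dst x a \<le> k")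
    case True
    then show ?thesis using Y by (intro exI[of _ Y]) auto
  next
    case False
    then have "\<forall>x\<in>Y. k < dst x a" "\<forall>x\<in>Y. k < dst a x"
      using insert.prems Y(1) dst_commute[of _ a] by (auto simp: subset_iff not_le)
    then have "\<forall>x\<in>insert a Y. \<forall>y\<in>insert a Y. x \<noteq> y \<longrightarrow> k < dst x y" using Y(2) by auto
    moreover have "\<forall>y\<in>insert a L. \<exists>x\<in>insert a Y. dst x y \<le> k" using Y(3) by force
    moreover have "insert a Y \<subseteq> insert a L" using Y(1) by blast
    ultimately show ?thesis by blast
  qed
qed simp

text \<open>Centres more than \<open>2 * k\<close> apart have disjoint balls of radius
  \<open>k\<close>, all of the same volume.\<close>

lemma packing:
  assumes "finite Y" "Y \<subseteq> carrier G" "\<And>x y. x \<in> Y \<Longrightarrow> y \<in> Y \<Longrightarrow> x \<noteq> y \<Longrightarrow> 2 * k < dst x y"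
    and A: "finite A" "\<And>x. x \<in> Y \<Longrightarrow> wball x k \<subseteq> A"
  shows "card Y * growth G S k \<le> card A"
proof -
  have "wball x k \<inter> wball y k = {}" if "x \<in> Y" "y \<in> Y" "x \<noteq> y" for x y
  proof -
    have "x \<in> carrier G" "y \<in> carrier G" using that assms(2) by auto
    moreover have "2 * k < dst x y" using assms(3) that by blast
    ultimately show ?thesis
      using dst_triangle[of x _ y] dst_commute[of y] by (fastforce simp: mem_wball)
  qed
  then have "card (\<Union>x\<in>Y. wball x k) = (\<Sum>x\<in>Y. card (wball x k))"
    using assms(1,2) finite_wball by (intro card_UN_disjoint) (auto simp: subset_iff)
  also have "\<dots> = card Y * growth G S k"
    using card_wball assms(2) by (simp add: subset_iff)
  finally have "card Y * growth G S k = card (\<Union>x\<in>Y. wball x k)" by simp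
  also have "\<dots> \<le> card A" using A by (intro card_mono) auto
  finally show ?thesis .
qed

end

subsection \<open>The dimension estimate\<close>

locale poly_cayley = cayley +
  fixes D :: nat and C1 C2 :: real
  assumes C1_pos: "C1 > 0" and C2_pos: "C2 > 0"
    and growth_lower: "n \<ge> 1 \<Longrightarrow> C1 * real n ^ D \<le> real (growth G S n)"
    and growth_upper: "n \<ge> 1 \<Longrightarrow> real (growth G S n) \<le> C2 * real n ^ D"
begin

lemma growth_ratio:
  assumes "k \<ge> 1" "r \<ge> 1"
  shows "real (growth G S (k * r)) \<le> (C2 * real k ^ D / C1) * real (growth G S r)"
proof -
  have "real (growth G S (k * r)) \<le> C2 * real (k * r) ^ D"
    using assms by (intro growth_upper) (simp add: Suc_le_eq)
  also have "\<dots> = (C2 * real k ^ D / C1) * (C1 * real r ^ D)"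
    using C1_pos by (simp add: power_mult_distrib)
  also have "\<dots> \<le> (C2 * real k ^ D / C1) * real (growth G S r)"
    using growth_lower[OF assms(2)] C1_pos C2_pos by (intro mult_left_mono) auto
  finally show ?thesis .
qed

lemma growth_pos: "n \<ge> 1 \<Longrightarrow> real (growth G S n) > 0"
  using growth_lower[of n] C1_pos by (intro less_le_trans[OF _ growth_lower]) auto

text \<open>Doubling bounds the volume at radius \<open>2 * r\<close> by that at radius
  \<open>r\<close>, which then cancels and leaves a constant independent of
  \<open>r\<close>.\<close>

lemma poincare':
  assumes "x0 \<in> carrier G" "sum f (wball x0 r) = 0" "r \<ge> 1"
  shows "(\<Sum>x\<in>wball x0 r. (f x)\<^sup>2)
    \<le> (C2 * 2 ^ D / C1) * ((2 * real r)\<^sup>2 * (\<Sum>x\<in>wball x0 (3 * r). grad_sq f x))"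
proof -
  let ?g = "real (growth G S r)"
  let ?E = "(2 * real r)\<^sup>2 * (\<Sum>x\<in>wball x0 (3 * r). grad_sq f x)"
  have E: "?E \<ge> 0" by (intro mult_nonneg_nonneg sum_nonneg grad_sq_nonneg) auto
  have "?g * (\<Sum>x\<in>wball x0 r. (f x)\<^sup>2) \<le> real (growth G S (2 * r)) * ?E"
    by (rule poincare[OF assms(1,2)])
  also have "\<dots> \<le> (C2 * 2 ^ D / C1) * ?g * ?E"
    using growth_ratio[of 2 r] assms(3) E by (intro mult_right_mono) auto
  finally have "?g * (\<Sum>x\<in>wball x0 r. (f x)\<^sup>2) \<le> ?g * ((C2 * 2 ^ D / C1) * ?E)"
    by (simp only: mult_ac)
  then show ?thesis by (rule mult_left_le_imp_le) (rule growth_pos[OF assms(3)])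
qed

section \<open>Whitney coverings of a ball\<close>

text \<open>\<open>Y s\<close> is the set of centres of the Whitney balls of radius comparable to \<open>2 ^ s * r\<close>; they
  cover the points whose distance to the complement of the ball of radius \<open>R\<close> is about
  \<open>2 ^ s * m * r\<close>.\<close>
definition whitney :: "'a \<Rightarrow> nat \<Rightarrow> nat \<Rightarrow> nat \<Rightarrow> (nat \<Rightarrow> 'a set) \<Rightarrow> bool" where
  "whitney p R m r Y \<longleftrightarrow> (\<forall>s.
     Y s \<subseteq> {x \<in> carrier G. 2 ^ s * (m * r) \<le> R - dst p x} \<and>
     (\<forall>x\<in>Y s. R \<le> dst p x + 2 * (2 ^ s * (m * r))) \<and>
     (\<forall>x\<in>Y s. \<forall>y\<in>Y s. x \<noteq> y \<longrightarrow> 2 * (2 ^ s * r) < dst x y) \<and>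
     (\<forall>y\<in>carrier G. 2 ^ s * (m * r) \<le> R - dst p y \<and> R - dst p y < 2 ^ Suc s * (m * r)
        \<longrightarrow> (\<exists>x\<in>Y s. dst x y \<le> 2 * (2 ^ s * r))))"

text \<open>A maximal separated set is chosen in each dyadic shell of depths; maximality gives the
  covering property.\<close>

lemma whitney_exists:
  assumes p: "p \<in> carrier G"
  shows "\<exists>Y. whitney p R m r Y"
proof -
  define L where "L = (\<lambda>s. {x \<in> carrier G. 2 ^ s * (m * r) \<le> R - dst p x \<and> R - dst p x < 2 ^ Suc s * (m * r)})"
  have "\<exists>Y. Y \<subseteq> L s \<and> (\<forall>x\<in>Y. \<forall>y\<in>Y. x \<noteq> y \<longrightarrow> 2 * (2 ^ s * r) < dst x y)
      \<and> (\<forall>y\<in>L s. \<exists>x\<in>Y. dst x y \<le> 2 * (2 ^ s * r))" for s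
  proof (cases "m * r = 0")
    case False
    have "L s \<subseteq> wball p R"
    proof
      fix x assume "x \<in> L s"
      then have "x \<in> carrier G" "2 ^ s * (m * r) \<le> R - dst p x" by (auto simp: L_def)
      moreover have "0 < 2 ^ s * (m * r)" using False by simp
      ultimately have "dst p x \<le> R" by linarith
      then show "x \<in> wball p R" using mem_wball[OF p] \<open>x \<in> carrier G\<close> by blast
    qed
    then have "finite (L s)" using finite_wball[OF p] finite_subset by blast
    then show ?thesis by (intro exists_maximal_separated) (auto simp: L_def)
  next
    case True
    \<comment> \<open>For \<open>m * r = 0\<close> the strict upper bound on the depth leaves no
      points.\<close>
    then have "L s = {}" by (auto simp: L_def)
    then show ?thesis by auto
  qed
  then obtain Y where Y: "\<And>s. Y s \<subseteq> L s \<and> (\<forall>x\<in>Y s. \<forall>y\<in>Y s. x \<noteq> y \<longrightarrow> 2 * (2 ^ s * r) < dst x y)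
      \<and> (\<forall>y\<in>L s. \<exists>x\<in>Y s. dst x y \<le> 2 * (2 ^ s * r))"
    by metis
  have "whitney p R m r Y"
    unfolding whitney_def
  proof (intro allI conjI)
    fix s
    note Ys = Y[of s, THEN conjunct1] Y[of s, THEN conjunct2, THEN conjunct1] Y[of s, THEN conjunct2, THEN conjunct2]
    show "Y s \<subseteq> {x \<in> carrier G. 2 ^ s * (m * r) \<le> R - dst p x}"
      using Ys(1) by (auto simp: L_def)
    show "\<forall>x\<in>Y s. R \<le> dst p x + 2 * (2 ^ s * (m * r))"
    proof
      fix x assume "x \<in> Y s"
      then have "R - dst p x < 2 ^ Suc s * (m * r)" using Ys(1) by (auto simp: L_def)
      then show "R \<le> dst p x + 2 * (2 ^ s * (m * r))" by simp
    qed
    show "\<forall>x\<in>Y s. \<forall>y\<in>Y s. x \<noteq> y \<longrightarrow> 2 * (2 ^ s * r) < dst x y" by (rule Ys(2))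
    show "\<forall>y\<in>carrier G. 2 ^ s * (m * r) \<le> R - dst p y \<and> R - dst p y < 2 ^ Suc s * (m * r)
        \<longrightarrow> (\<exists>x\<in>Y s. dst x y \<le> 2 * (2 ^ s * r))"
      using Ys(3) by (simp add: L_def del: power_Suc)
  qed
  then show ?thesis by blast
qed

lemma whitney_cover:
  assumes "whitney p R m r Y" "y \<in> carrier G"
    and "2 ^ s * (m * r) \<le> R - dst p y" "R - dst p y < 2 ^ Suc s * (m * r)"
  obtains x where "x \<in> Y s" "dst x y \<le> 2 * (2 ^ s * r)"
proof -
  have "\<forall>y\<in>carrier G. 2 ^ s * (m * r) \<le> R - dst p y \<and> R - dst p y < 2 ^ Suc s * (m * r)
        \<longrightarrow> (\<exists>x\<in>Y s. dst x y \<le> 2 * (2 ^ s * r))"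
    using assms(1) unfolding whitney_def by (elim allE[of _ s] conjE)
  then show ?thesis using assms(2-) that by (auto simp del: power_Suc)
qed

lemma whitney_finite:
  assumes "whitney p R m r Y" "p \<in> carrier G" "m \<ge> 1" "r \<ge> 1"
  shows "finite (Y s)" "Y s \<subseteq> carrier G"
proof -
  have "Y s \<subseteq> wball p R"
  proof
    fix x assume "x \<in> Y s"
    then have "x \<in> carrier G" "2 ^ s * (m * r) \<le> R - dst p x"
      using assms(1) unfolding whitney_def by blast+
    moreover have "0 < 2 ^ s * (m * r)" using assms by simp
    ultimately have "dst p x \<le> R" by linarith
    then show "x \<in> wball p R" using \<open>x \<in> carrier G\<close> assms(2) by (simp add: mem_wball)
  qed
  then show "finite (Y s)" "Y s \<subseteq> carrier G"
    using finite_wball[OF assms(2)] finite_subset wball_carrier by blast+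
qed

text \<open>For \<open>m \<ge> 12\<close> the disjoint balls of radius \<open>2 ^ s * r\<close> are
  small against the depth of their centres, so they stay in an annulus along the boundary of width
  comparable to that depth.\<close>

lemma whitney_card:
  assumes W: "whitney p R m r Y" and p: "p \<in> carrier G" and "m \<ge> 12" "r \<ge> 1"
  shows "card (Y s) * growth G S (2 ^ s * r)
    \<le> card {y \<in> carrier G. dst p y < R \<and> R \<le> dst p y + 4 * 2 ^ s * (m * r)}"
proof (rule packing)
  show "finite (Y s)" "Y s \<subseteq> carrier G"
    using whitney_finite[OF W p] assms by auto
  show "2 * (2 ^ s * r) < dst x y" if "x \<in> Y s" "y \<in> Y s" "x \<noteq> y" for x y
    using W that unfolding whitney_def by blast
  show "finite {y \<in> carrier G. dst p y < R \<and> R \<le> dst p y + 4 * 2 ^ s * (m * r)}"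
    by (rule finite_subset[OF _ finite_wball[OF p, of R]]) (auto simp: mem_wball p)
  fix x assume x: "x \<in> Y s"
  define k where "k = 2 ^ s * r"
  define a where "a = 2 ^ s * (m * r)"
  have "k \<ge> 1" using assms(4) by (simp add: k_def Suc_le_eq)
  have "12 * k \<le> a" using assms(3) by (simp add: k_def a_def)
  have xc: "x \<in> carrier G" "a \<le> R - dst p x" "R \<le> dst p x + 2 * a"
    using W x unfolding whitney_def a_def by blast+
  show "wball x (2 ^ s * r) \<subseteq> {y \<in> carrier G. dst p y < R \<and> R \<le> dst p y + 4 * 2 ^ s * (m * r)}"
  proof
    fix y assume "y \<in> wball x (2 ^ s * r)"
    then have y: "y \<in> carrier G" "dst x y \<le> k" using xc by (auto simp: mem_wball k_def)
    have "dst p y \<le> dst p x + dst x y" "dst p x \<le> dst p y + dst x y"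
      using dst_triangle[of p x y] dst_triangle[of p y x] dst_commute[of x y] p xc y by auto
    then have "dst p y < R" "R \<le> dst p y + 4 * a"
      using xc y \<open>k \<ge> 1\<close> \<open>12 * k \<le> a\<close> by linarith+
    then show "y \<in> {y \<in> carrier G. dst p y < R \<and> R \<le> dst p y + 4 * 2 ^ s * (m * r)}"
      using y by (simp add: a_def mult.assoc)
  qed
qed

text \<open>Disjoint balls of radius \<open>k\<close> around these centres fit into the ball of
  radius \<open>7 * k\<close> about \<open>y\<close>, which has comparable volume.\<close>

lemma separated_overlap:
  assumes "finite Y" "Y \<subseteq> carrier G" "y \<in> carrier G" "k \<ge> 1"
    and sep: "\<And>x z. x \<in> Y \<Longrightarrow> z \<in> Y \<Longrightarrow> x \<noteq> z \<Longrightarrow> 2 * k < dst x z"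
  shows "real (card {x \<in> Y. dst x y \<le> 6 * k}) \<le> C2 * 7 ^ D / C1"
proof -
  let ?Z = "{x \<in> Y. dst x y \<le> 6 * k}"
  have "card ?Z * growth G S k \<le> card (wball y (7 * k))"
  proof (rule packing)
    fix x assume x: "x \<in> ?Z"
    then have xc: "x \<in> carrier G" using assms by auto
    show "wball x k \<subseteq> wball y (7 * k)"
    proof
      fix z assume "z \<in> wball x k"
      then have "z \<in> carrier G" "dst x z \<le> k" using mem_wball xc by auto
      then show "z \<in> wball y (7 * k)"
        using dst_triangle[of y x z] dst_commute[of x y] x xc assms(3) by (auto simp: mem_wball)
    qed
  qed (use assms finite_wball in auto)
  then have "real (card ?Z) * real (growth G S k) \<le> real (growth G S (7 * k))"
    using card_wball[OF assms(3)] by (simp flip: of_nat_mult)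
  also have "\<dots> \<le> (C2 * 7 ^ D / C1) * real (growth G S k)"
    using growth_ratio[of 7 k] assms(4) by simp
  finally show ?thesis
    using growth_pos[OF assms(4)] by (rule mult_right_le_imp_le)
qed

text \<open>The Poincare inequality on each Whitney ball costs a factor \<open>(dist / m)\<^sup>2\<close>, where \<open>dist\<close> is
  the distance to the complement, and this factor is absorbed by the cutoff in \<open>caccioppoli\<close>.\<close>
lemma whitney_contract:
  assumes W: "whitney p R m r Y" and p: "p \<in> carrier G" and m: "m \<ge> 12" and r: "r \<ge> 1"
    and R: "m * r < R" and u: "harmonic u"
    and mean: "\<And>s x. s < R \<Longrightarrow> x \<in> Y s \<Longrightarrow> sum u (wball x (2 * (2 ^ s * r))) = 0"
  shows "(\<Sum>x\<in>wball p (R - m * r). (u x)\<^sup>2)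
    \<le> 512 * (C2 * 2 ^ D / C1) * (C2 * 7 ^ D / C1) * real (card S) / (real m)\<^sup>2
        * (\<Sum>x\<in>wball p R. (u x)\<^sup>2)"
proof -
  define c where "c = C2 * 2 ^ D / C1"
  define c' where "c' = C2 * 7 ^ D / C1"
  define \<rho> where "\<rho> = (\<lambda>s. 2 ^ s * r)"
  \<comment> \<open>This region contains the enlarged balls of level \<open>s\<close>: its points
    keep at least half of the depth \<open>2 ^ s * (m * r)\<close>.\<close>
  define Z where "Z = (\<lambda>s. {y \<in> wball p R. 2 ^ s * (m * r) \<le> 2 * (R - dst p y)})"
  let ?g = "grad_sq u"
  have c: "c \<ge> 0" "c' \<ge> 0" using C1_pos C2_pos by (auto simp: c_def c'_def)
  have \<rho>: "\<rho> s \<ge> 1" for s using r by (simp add: \<rho>_def Suc_le_eq)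
  have \<rho>m: "12 * \<rho> s \<le> 2 ^ s * (m * r)" for s using m by (simp add: \<rho>_def)
  have finY: "finite (Y s)" "Y s \<subseteq> carrier G" for s
    using whitney_finite[OF W p] m r by auto
  have finZ: "finite (Z s)" for s using finite_wball[OF p] by (simp add: Z_def)
  have Yd: "2 ^ s * (m * r) \<le> R - dst p x" if "x \<in> Y s" for s x
    using W that unfolding whitney_def by blast
  have cover: "wball p (R - m * r) \<subseteq> (\<Union>s<R. \<Union>x\<in>Y s. wball x (2 * \<rho> s))"
  proof
    fix y assume "y \<in> wball p (R - m * r)"
    then have y: "y \<in> carrier G" "dst p y \<le> R - m * r" using mem_wball p by auto
    \<comment> \<open>The level of \<open>y\<close> is the dyadic order of its depth in units of
      \<open>m * r\<close>.\<close>
    define k where "k = (R - dst p y) div (m * r)"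
    have mr: "m * r > 0" using m r by auto
    have "m * r \<le> R - dst p y" using y R by linarith
    then have "k \<ge> 1" using mr by (simp add: k_def div_greater_zero_iff Suc_le_eq)
    then obtain s where s: "2 ^ s \<le> k" "k < 2 ^ (s + 1)"
      using ex_power_ivl1[of 2 k] by auto
    have "2 ^ s * (m * r) \<le> k * (m * r)" using s by (intro mult_right_mono) auto
    also have "\<dots> \<le> R - dst p y" by (simp only: k_def div_times_less_eq_dividend)
    finally have s1: "2 ^ s * (m * r) \<le> R - dst p y" .
    have s2: "R - dst p y < 2 ^ Suc s * (m * r)"
      using s(2) mr by (simp add: k_def div_less_iff_less_mult del: power_Suc)
    obtain x where x: "x \<in> Y s" "dst x y \<le> 2 * \<rho> s"
      by (rule whitney_cover[OF W y(1) s1 s2]) (simp add: \<rho>_def)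
    \<comment> \<open>Depths are at most \<open>R\<close>, so levels below \<open>R\<close> suffice
      and the index set is finite.\<close>
    have "s < 2 ^ s * 1" by simp
    also have "\<dots> \<le> 2 ^ s * (m * r)" using mr by (intro mult_left_mono) auto
    also have "\<dots> \<le> R" using s1 by linarith
    finally have "s < R" .
    moreover have "y \<in> wball x (2 * \<rho> s)" using x y finY(2)[of s] by (auto simp: mem_wball subset_iff)
    ultimately show "y \<in> (\<Union>s<R. \<Union>x\<in>Y s. wball x (2 * \<rho> s))" using x by blast
  qed
  have finB: "finite (wball x n)" if "x \<in> Y s" for x n s
    using finite_wball finY that by blast
  have "(\<Sum>x\<in>wball p (R - m * r). (u x)\<^sup>2) \<le> (\<Sum>y\<in>(\<Union>s<R. \<Union>x\<in>Y s. wball x (2 * \<rho> s)). (u y)\<^sup>2)"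
    using cover finY finB by (intro sum_mono2) auto
  also have "\<dots> \<le> (\<Sum>s<R. \<Sum>y\<in>(\<Union>x\<in>Y s. wball x (2 * \<rho> s)). (u y)\<^sup>2)"
    using finY finB by (intro sum_UN_le) auto
  also have "\<dots> \<le> (\<Sum>s<R. \<Sum>x\<in>Y s. \<Sum>y\<in>wball x (2 * \<rho> s). (u y)\<^sup>2)"
    using finY finB by (intro sum_mono sum_UN_le) auto
  also have "\<dots> \<le> (\<Sum>s<R. \<Sum>x\<in>Y s. c * (16 * (real (\<rho> s))\<^sup>2 * (\<Sum>y\<in>wball x (6 * \<rho> s). ?g y)))"
  proof (intro sum_mono)
    fix s x assume "s \<in> {..<R}" "x \<in> Y s"
    then have "(\<Sum>y\<in>wball x (2 * \<rho> s). (u y)\<^sup>2)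
        \<le> c * ((2 * real (2 * \<rho> s))\<^sup>2 * (\<Sum>y\<in>wball x (3 * (2 * \<rho> s)). ?g y))"
      unfolding c_def using mean[of s x] finY \<rho>[of s] by (intro poincare') (auto simp: \<rho>_def)
    then show "(\<Sum>y\<in>wball x (2 * \<rho> s). (u y)\<^sup>2)
        \<le> c * (16 * (real (\<rho> s))\<^sup>2 * (\<Sum>y\<in>wball x (6 * \<rho> s). ?g y))"
      by (simp add: power_mult_distrib)
  qed
  also have "\<dots> = (\<Sum>s<R. 16 * c * (real (\<rho> s))\<^sup>2 * (\<Sum>x\<in>Y s. \<Sum>y\<in>wball x (6 * \<rho> s). ?g y))"
    by (simp add: sum_distrib_left mult_ac)
  also have "\<dots> \<le> (\<Sum>s<R. 16 * c * (real (\<rho> s))\<^sup>2 * (c' * (\<Sum>y\<in>Z s. ?g y)))"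
  proof (intro sum_mono mult_left_mono)
    fix s
    \<comment> \<open>Since \<open>m \<ge> 12\<close>, the radius \<open>6 * \<rho> s\<close> uses
      up at most half of the depth of the centre.\<close>
    have "wball x (6 * \<rho> s) = {y \<in> Z s. dst x y \<le> 6 * \<rho> s}" if x: "x \<in> Y s" for x
    proof -
      have xc: "x \<in> carrier G" using finY x by blast
      have "y \<in> Z s" if "y \<in> carrier G" "dst x y \<le> 6 * \<rho> s" for y
      proof -
        have "dst p y \<le> dst p x + dst x y" using dst_triangle p xc that by blast
        then have "dst p y \<le> R" "2 ^ s * (m * r) \<le> 2 * (R - dst p y)"
          using Yd[OF x] \<rho>m[of s] \<rho>[of s] that by linarith+
        then show ?thesis using that p by (simp add: Z_def mem_wball)
      qed
      then show ?thesis using xc wball_carrier by (auto simp: mem_wball Z_def)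
    qed
    then have "(\<Sum>x\<in>Y s. \<Sum>y\<in>wball x (6 * \<rho> s). ?g y) = (\<Sum>x\<in>Y s. \<Sum>y\<in>{y \<in> Z s. dst x y \<le> 6 * \<rho> s}. ?g y)"
      by simp
    \<comment> \<open>Counting by points instead of centres: each \<open>y\<close> lies in at most
      \<open>c'\<close> enlarged balls of level \<open>s\<close>.\<close>
    also have "\<dots> = (\<Sum>y\<in>Z s. \<Sum>x\<in>{x \<in> Y s. dst x y \<le> 6 * \<rho> s}. ?g y)"
      by (rule sum.swap_restrict[OF finY(1) finZ])
    also have "\<dots> = (\<Sum>y\<in>Z s. real (card {x \<in> Y s. dst x y \<le> 6 * \<rho> s}) * ?g y)" by simp
    also have "\<dots> \<le> (\<Sum>y\<in>Z s. c' * ?g y)"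
    proof (intro sum_mono mult_right_mono grad_sq_nonneg)
      fix y assume "y \<in> Z s"
      then have "y \<in> carrier G" using wball_carrier by (auto simp: Z_def)
      then show "real (card {x \<in> Y s. dst x y \<le> 6 * \<rho> s}) \<le> c'"
        unfolding c'_def using W unfolding whitney_def \<rho>_def[symmetric]
        by (intro separated_overlap finY \<rho>) (auto simp: \<rho>_def)
    qed
    also have "\<dots> = c' * (\<Sum>y\<in>Z s. ?g y)" by (simp add: sum_distrib_left)
    finally show "(\<Sum>x\<in>Y s. \<Sum>y\<in>wball x (6 * \<rho> s). ?g y) \<le> c' * (\<Sum>y\<in>Z s. ?g y)" .
  qed (use c in auto)
  also have "\<dots> = 16 * c * c' * (\<Sum>s<R. \<Sum>y\<in>Z s. (real (\<rho> s))\<^sup>2 * ?g y)"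
    by (simp add: sum_distrib_left mult_ac)
  also have "(\<Sum>s<R. \<Sum>y\<in>Z s. (real (\<rho> s))\<^sup>2 * ?g y)
      = (\<Sum>y\<in>wball p R. \<Sum>s\<in>{s \<in> {..<R}. 2 ^ s * (m * r) \<le> 2 * (R - dst p y)}. (real (\<rho> s))\<^sup>2 * ?g y)"
    unfolding Z_def by (rule sum.swap_restrict) (auto simp: finite_wball p)
  also have "16 * c * c' * \<dots> \<le> 16 * c * c' * (\<Sum>y\<in>wball p R. 8 / (real m)\<^sup>2 * ((real (R - dst p y))\<^sup>2 * ?g y))"
  proof (intro mult_left_mono sum_mono)
    fix y
    define b where "b = 2 * real (R - dst p y)"
    have mpos: "real m > 0" using m by simp
    have set_eq: "{s \<in> {..<R}. 2 ^ s * (m * r) \<le> 2 * (R - dst p y)}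
        = {s. s < R \<and> 2 ^ s * (real m * real r) \<le> b}"
    proof -
      have "2 ^ s * (m * r) \<le> 2 * (R - dst p y) \<longleftrightarrow> 2 ^ s * (real m * real r) \<le> b" for s
      proof -
        have "2 ^ s * (real m * real r) = real (2 ^ s * (m * r))" "b = real (2 * (R - dst p y))"
          by (simp_all add: b_def)
        then show ?thesis by (simp only: of_nat_le_iff)
      qed
      then show ?thesis by simp
    qed
    \<comment> \<open>At a fixed \<open>y\<close> the sum over levels is geometric, with largest
      term of the order of the squared depth divided by \<open>m\<close> squared. This produces the
      cutoff weight of \<open>caccioppoli\<close>.\<close>
    have "(\<Sum>s\<in>{s \<in> {..<R}. 2 ^ s * (m * r) \<le> 2 * (R - dst p y)}. (real (\<rho> s))\<^sup>2)
      = (\<Sum>s | s < R \<and> 2 ^ s * (real m * real r) \<le> b. (2 ^ s * (real m * real r))\<^sup>2) / (real m)\<^sup>2"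
      unfolding set_eq sum_divide_distrib using mpos
      by (intro sum.cong) (auto simp: \<rho>_def power_mult_distrib)
    also have "\<dots> \<le> 2 * b\<^sup>2 / (real m)\<^sup>2"
      by (intro divide_right_mono sum_dyadic_squares_le) auto
    also have "\<dots> = 8 / (real m)\<^sup>2 * (real (R - dst p y))\<^sup>2"
      by (simp add: b_def power_mult_distrib)
    finally have "(\<Sum>s\<in>{s \<in> {..<R}. 2 ^ s * (m * r) \<le> 2 * (R - dst p y)}. (real (\<rho> s))\<^sup>2) * ?g y
      \<le> 8 / (real m)\<^sup>2 * (real (R - dst p y))\<^sup>2 * ?g y"
      by (intro mult_right_mono grad_sq_nonneg)
    then show "(\<Sum>s\<in>{s \<in> {..<R}. 2 ^ s * (m * r) \<le> 2 * (R - dst p y)}. (real (\<rho> s))\<^sup>2 * ?g y)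
      \<le> 8 / (real m)\<^sup>2 * ((real (R - dst p y))\<^sup>2 * ?g y)"
      by (simp only: sum_distrib_right mult.assoc)
  qed (use c in auto)
  also have "\<dots> = 128 * c * c' / (real m)\<^sup>2 * (\<Sum>y\<in>wball p R. (real (R - dst p y))\<^sup>2 * ?g y)"
    unfolding sum_distrib_left[symmetric] by simp
  also have "\<dots> \<le> 128 * c * c' / (real m)\<^sup>2 * (4 * real (card S) * (\<Sum>x\<in>wball p R. (u x)\<^sup>2))"
    using c by (intro mult_left_mono caccioppoli p u) auto
  also have "\<dots> = 512 * c * c' * real (card S) / (real m)\<^sup>2 * (\<Sum>x\<in>wball p R. (u x)\<^sup>2)" by simp
  finally show ?thesis by (simp only: c_def c'_def)
qed

text \<open>One functional is used per Whitney ball, the sum over it. Elimination leaves at least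
  \<open>length vs\<close> minus the number of balls functions on which all functionals vanish, and
  their span contracts by \<open>\<eta>\<close>. The existential \<open>n\<close> avoids a truncated
  subtraction.\<close>

lemma gram_step:
  assumes p: "p \<in> carrier G" and m: "m \<ge> 12" and r: "r \<ge> 1" and R: "m * r < R"
    and W: "whitney p R m r Y" and vs: "\<And>v. v \<in> set vs \<Longrightarrow> harmonic v"
    and \<eta>: "512 * (C2 * 2 ^ D / C1) * (C2 * 7 ^ D / C1) * real (card S) / (real m)\<^sup>2 \<le> \<eta>" "\<eta> > 0"
  shows "\<exists>n. length vs \<le> n + (\<Sum>s<R. card (Y s))
    \<and> gram (wball p (R - m * r)) vs \<le> \<eta> ^ n * gram (wball p R) vs"
proof -
  have finY: "finite (Y s)" for s
    using whitney_finite[OF W p] m r by auto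
  obtain zs where zs: "set zs = Sigma {..<R} Y" "distinct zs"
    using finite_distinct_list[of "Sigma {..<R} Y"] finY by auto
  have len: "length zs = (\<Sum>s<R. card (Y s))"
    using distinct_card[OF zs(2)] finY by (simp add: zs(1))
  define l :: "nat \<times> 'a \<Rightarrow> ('a \<Rightarrow> real) \<Rightarrow> real" where "l = (\<lambda>(s, x) u. sum u (wball x (2 * (2 ^ s * r))))"
  have lin: "\<forall>u v c. l z (u + fscale c v) = l z u + c * l v' v" if "v' = z" for z v'
    using that by (simp add: l_def case_prod_unfold sum.distrib fscale_apply sum_distrib_left)
  have "\<exists>us ws. length us \<le> length (map l zs) \<and> length us + length ws = length vs
    \<and> set (us @ ws) \<subseteq> fs.span (set vs)
    \<and> (\<forall>l\<in>set (map l zs). \<forall>w\<in>set ws. l w = 0) \<and> (\<forall>F. finite F \<longrightarrow> gram F (us @ ws) = gram F vs)"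
    by (rule gram_adapted_list) (use lin in auto)
  then obtain us ws where us: "length us \<le> length zs" "length us + length ws = length vs"
    "set (us @ ws) \<subseteq> fs.span (set vs)" "\<And>z w. z \<in> set zs \<Longrightarrow> w \<in> set ws \<Longrightarrow> l z w = 0"
    "\<And>F. finite F \<Longrightarrow> gram F (us @ ws) = gram F vs"
    by (metis (no_types, lifting) image_eqI length_map list.set_map)
  have zero: "l z u = 0" if "z \<in> set zs" "u \<in> fs.span (set ws)" for z u
  proof -
    have "fs.subspace {u. l z u = 0}"
      by (rule fs.subspaceI) (auto simp: l_def case_prod_unfold sum.distrib fscale_apply sum_distrib_left[symmetric])
    moreover have "set ws \<subseteq> {u. l z u = 0}" using us(4) that(1) by blast
    ultimately show ?thesis using fs.span_minimal that(2) by blast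
  qed
  have "gram (wball p (R - m * r)) (us @ ws) \<le> \<eta> ^ length ws * gram (wball p R) (us @ ws)"
  proof (rule gram_contract)
    fix u assume u: "u \<in> fs.span (set ws)"
    have "set ws \<subseteq> fs.span (set vs)" using us(3) by auto
    then have "u \<in> fs.span (set vs)" using fs.span_minimal[OF _ fs.subspace_span] u by blast
    then have "harmonic u" using harmonic_span vs by blast
    moreover have "sum u (wball x (2 * (2 ^ s * r))) = 0" if "s < R" "x \<in> Y s" for s x
      using zero[OF _ u, of "(s, x)"] that zs(1) by (simp add: l_def)
    ultimately have "(\<Sum>x\<in>wball p (R - m * r). (u x)\<^sup>2)
        \<le> 512 * (C2 * 2 ^ D / C1) * (C2 * 7 ^ D / C1) * real (card S) / (real m)\<^sup>2
        * (\<Sum>x\<in>wball p R. (u x)\<^sup>2)"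
      by (intro whitney_contract[OF W p m r R])
    also have "\<dots> \<le> \<eta> * (\<Sum>x\<in>wball p R. (u x)\<^sup>2)"
      using \<eta> by (intro mult_right_mono sum_nonneg) auto
    finally show "ip (wball p (R - m * r)) u u \<le> \<eta> * ip (wball p R) u u"
      by (simp add: ip_def power2_eq_square)
  qed (use finite_wball p wball_mono \<eta> in auto)
  then have "gram (wball p (R - m * r)) vs \<le> \<eta> ^ length ws * gram (wball p R) vs"
    using us(5) finite_wball[OF p] by simp
  then show ?thesis using us(1,2) len by (intro exI[of _ "length ws"]) auto
qed

section \<open>Counting Whitney balls over all steps\<close>

text \<open>Double counting: by \<open>card_multiples_in_window\<close>, each point of the final
  ball lies in at most \<open>t\<close> of the annuli.\<close>

lemma sum_annuli_le:
  assumes p: "p \<in> carrier G" and "M > 0"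
  shows "(\<Sum>j<K. card {y \<in> carrier G. dst p y < N + Suc j * M \<and> N + Suc j * M \<le> dst p y + t * M})
    \<le> t * growth G S (N + K * M)"
proof -
  let ?B = "wball p (N + K * M)"
  let ?P = "\<lambda>j y. dst p y < N + Suc j * M \<and> N + Suc j * M \<le> dst p y + t * M"
  have "{y \<in> carrier G. ?P j y} = {y \<in> ?B. ?P j y}" if "j < K" for j
  proof -
    have "Suc j * M \<le> K * M" using that by (intro mult_right_mono) auto
    then show ?thesis using p by (auto simp: mem_wball)
  qed
  then have "(\<Sum>j<K. card {y \<in> carrier G. ?P j y}) = (\<Sum>j<K. card {y \<in> ?B. ?P j y})"
    by (intro sum.cong) auto
  also have "\<dots> = (\<Sum>j<K. \<Sum>y\<in>{y \<in> ?B. ?P j y}. 1)" by simp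
  also have "\<dots> = (\<Sum>y\<in>?B. \<Sum>j\<in>{j \<in> {..<K}. ?P j y}. 1)"
    by (rule sum.swap_restrict) (auto simp: finite_wball p)
  also have "\<dots> = (\<Sum>y\<in>?B. card {j. j < K \<and> ?P j y})" by simp
  also have "\<dots> \<le> (\<Sum>y\<in>?B. t)"
    using card_multiples_in_window[OF assms(2)] by (intro sum_mono)
  also have "\<dots> = t * growth G S (N + K * M)" using card_wball[OF p] by simp
  finally show ?thesis .
qed

text \<open>At level \<open>s\<close> the annuli contribute a factor \<open>2 ^ s\<close> and the
  volume of the packed balls divides by \<open>(2 ^ s) ^ D\<close>, so the levels sum up for
  \<open>D \<ge> 2\<close>. The total over \<open>K\<close> steps is of order \<open>K ^ D\<close>,
  hence \<open>K ^ (D - 1)\<close> per step.\<close>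

lemma sum_whitney_card_le:
  assumes p: "p \<in> carrier G" and m: "m \<ge> 12" and r: "r \<ge> 1" and D: "D \<ge> 2" and K: "K \<ge> 1"
    and W: "\<And>j. j < K \<Longrightarrow> whitney p (K * (m * r) + Suc j * (m * r)) m r (Y j)"
  shows "(\<Sum>j<K. \<Sum>s<n j. real (card (Y j s))) \<le> 8 * (C2 / C1) * real (2 * m) ^ D * real K ^ D"
proof -
  define M where "M = m * r"
  define c where "c = 4 * (C2 / C1) * real (2 * m) ^ D * real K ^ D"
  have c: "c \<ge> 0" using C1_pos C2_pos by (simp add: c_def)
  have M: "M > 0" using m r by (simp add: M_def)
  have level: "(\<Sum>j<K. real (card (Y j s))) \<le> c * (1 / 2) ^ s" for s
  proof -
    define g where "g = growth G S (2 ^ s * r)"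
    have k: "2 ^ s * r \<ge> 1" using r by (simp add: Suc_le_eq)
    have "(\<Sum>j<K. card (Y j s)) * g \<le> (\<Sum>j<K. card {y \<in> carrier G. dst p y < K * M + Suc j * M
        \<and> K * M + Suc j * M \<le> dst p y + (4 * 2 ^ s) * M})"
      unfolding sum_distrib_right g_def M_def
      by (intro sum_mono whitney_card[OF _ p m r] W) auto
    also have "\<dots> \<le> 4 * 2 ^ s * growth G S (K * M + K * M)"
      by (rule sum_annuli_le[OF p M])
    finally have "(\<Sum>j<K. card (Y j s)) * g \<le> 4 * 2 ^ s * growth G S (2 * (K * M))"
      by (simp only: mult_2)
    then have "real ((\<Sum>j<K. card (Y j s)) * g) \<le> real (4 * 2 ^ s * growth G S (2 * (K * M)))"
      by (simp only: of_nat_le_iff)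
    then have "(\<Sum>j<K. real (card (Y j s))) * real g \<le> 4 * 2 ^ s * real (growth G S (2 * (K * M)))"
      by simp
    also have "\<dots> \<le> 4 * 2 ^ s * (C2 * real (2 * (K * M)) ^ D)"
      using K M by (intro mult_left_mono growth_upper) (auto simp: Suc_le_eq)
    finally have "(\<Sum>j<K. real (card (Y j s))) * real g \<le> 4 * 2 ^ s * (C2 * real (2 * (K * M)) ^ D)" .
    moreover have "(\<Sum>j<K. real (card (Y j s))) * (C1 * real (2 ^ s * r) ^ D) \<le> (\<Sum>j<K. real (card (Y j s))) * real g"
      unfolding g_def by (intro mult_left_mono growth_lower k sum_nonneg) auto
    ultimately have "(\<Sum>j<K. real (card (Y j s))) * (C1 * real (2 ^ s * r) ^ D) \<le> 4 * 2 ^ s * (C2 * real (2 * (K * M)) ^ D)"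
      by linarith
    also have "\<dots> = c * 2 ^ s * (C1 * real r ^ D)"
      using C1_pos by (simp add: c_def M_def power_mult_distrib)
    also have "\<dots> \<le> c * ((1 / 2) ^ s * (2 ^ s) ^ D) * (C1 * real r ^ D)"
    proof -
      \<comment> \<open>Here \<open>D \<ge> 2\<close> enters; it gains the decay
        \<open>(1 / 2) ^ s\<close>.\<close>
      have "(2::real) ^ s * 2 ^ s = (2 ^ s) ^ 2" by (simp add: power2_eq_square)
      also have "\<dots> \<le> (2 ^ s) ^ D" using D by (intro power_increasing) auto
      finally have "(2::real) ^ s \<le> (1 / 2) ^ s * (2 ^ s) ^ D"
        by (simp add: power_one_over field_simps)
      then show ?thesis using c C1_pos by (intro mult_right_mono mult_left_mono) auto
    qed
    also have "\<dots> = c * (1 / 2) ^ s * (C1 * real (2 ^ s * r) ^ D)"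
      by (simp add: power_mult_distrib)
    finally show ?thesis
      by (rule mult_right_le_imp_le) (use C1_pos r in simp)
  qed
  \<comment> \<open>The number of levels depends on \<open>j\<close>; a common bound allows the sums
    to be swapped.\<close>
  define n' where "n' = Max (insert 0 (n ` {..<K}))"
  have n': "n j \<le> n'" if "j < K" for j using that by (auto simp: n'_def)
  have "(\<Sum>j<K. \<Sum>s<n j. real (card (Y j s))) \<le> (\<Sum>j<K. \<Sum>s<n'. real (card (Y j s)))"
    using n' by (intro sum_mono sum_mono2) auto
  also have "\<dots> = (\<Sum>s<n'. \<Sum>j<K. real (card (Y j s)))" by (rule sum.swap)
  also have "\<dots> \<le> (\<Sum>s<n'. c * (1 / 2) ^ s)" by (intro sum_mono level)
  also have "\<dots> = c * (\<Sum>s<n'. (1 / 2) ^ s)" by (simp add: sum_distrib_left)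
  also have "\<dots> \<le> c * 2"
  proof (rule mult_left_mono)
    have "(\<Sum>s<n'. (1 / 2 :: real) ^ s) = 2 - 2 * (1 / 2) ^ n'"
      by (induction n') auto
    then show "(\<Sum>s<n'. (1 / 2 :: real) ^ s) \<le> 2" by simp
  qed (rule c)
  finally show ?thesis by (simp add: c_def)
qed

section \<open>The dimension bound for \<open>D \<ge> 2\<close>\<close>

text \<open>By Hadamard's inequality each function contributes its squared norm: squared values of
  order \<open>n ^ (2 * K)\<close> on a ball of volume of order \<open>n ^ D\<close>.\<close>

lemma gram_le_poly:
  assumes p: "p \<in> carrier G"
    and "\<And>v. v \<in> set vs \<Longrightarrow> \<exists>C. \<forall>x\<in>carrier G. \<bar>v x\<bar> \<le> C * (real (dst p x) + 1) ^ K"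
  shows "\<exists>B\<ge>0. \<forall>n\<ge>1. gram (wball p n) vs \<le> B * real (n + 1) ^ (length vs * (2 * K + D))"
proof -
  have "\<exists>B\<ge>0. \<forall>n\<ge>1. (\<Prod>v\<leftarrow>vs. ip (wball p n) v v) \<le> B * real (n + 1) ^ (length vs * (2 * K + D))"
    using assms(2)
  proof (induction vs)
    case Nil
    show ?case by (intro exI[of _ 1]) auto
  next
    case (Cons v vs)
    have "\<exists>B\<ge>0. \<forall>n\<ge>1. (\<Prod>v\<leftarrow>vs. ip (wball p n) v v) \<le> B * real (n + 1) ^ (length vs * (2 * K + D))"
      by (rule Cons.IH) (use Cons.prems in auto)
    then obtain B where B: "B \<ge> 0" "\<And>n. n \<ge> 1 \<Longrightarrow> (\<Prod>v\<leftarrow>vs. ip (wball p n) v v) \<le> B * real (n + 1) ^ (length vs * (2 * K + D))"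
      by blast
    obtain C where C: "\<And>x. x \<in> carrier G \<Longrightarrow> \<bar>v x\<bar> \<le> C * (real (dst p x) + 1) ^ K"
      using Cons.prems by (meson list.set_intros(1))
    have Cn: "C \<ge> 0" using C[OF p] by (simp add: abs_le_iff)
    have "ip (wball p n) v v \<le> (C2 * C\<^sup>2) * real (n + 1) ^ (2 * K + D)" if n: "n \<ge> 1" for n
    proof -
      have "ip (wball p n) v v \<le> (\<Sum>x\<in>wball p n. (C * real (n + 1) ^ K)\<^sup>2)"
        unfolding ip_def
      proof (rule sum_mono)
        fix x assume "x \<in> wball p n"
        then have x: "x \<in> carrier G" "dst p x \<le> n" using mem_wball p by auto
        then have "\<bar>v x\<bar> \<le> C * (real (dst p x) + 1) ^ K" using C by blast
        also have "\<dots> \<le> C * real (n + 1) ^ K"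
          using x Cn by (intro mult_left_mono power_mono) auto
        finally have "\<bar>v x\<bar>\<^sup>2 \<le> (C * real (n + 1) ^ K)\<^sup>2" by (rule power_mono) simp
        then show "v x * v x \<le> (C * real (n + 1) ^ K)\<^sup>2" by (simp add: power2_eq_square)
      qed
      also have "\<dots> = real (growth G S n) * (C * real (n + 1) ^ K)\<^sup>2"
        using card_wball[OF p] by simp
      also have "\<dots> \<le> (C2 * real (n + 1) ^ D) * (C * real (n + 1) ^ K)\<^sup>2"
      proof (rule mult_right_mono)
        have "C2 * real n ^ D \<le> C2 * real (n + 1) ^ D"
          using C2_pos by (intro mult_left_mono power_mono) auto
        then show "real (growth G S n) \<le> C2 * real (n + 1) ^ D" using growth_upper[OF n] by linarith
      qed simp
      also have "\<dots> = (C2 * C\<^sup>2) * real (n + 1) ^ (2 * K + D)"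
        by (simp only: power_mult_distrib power_add power_mult[symmetric] mult_ac)
      finally show ?thesis .
    qed
    then have "(\<Prod>v\<leftarrow>v # vs. ip (wball p n) v v)
        \<le> ((C2 * C\<^sup>2) * real (n + 1) ^ (2 * K + D)) * (B * real (n + 1) ^ (length vs * (2 * K + D)))"
      if "n \<ge> 1" for n
      using B that C2_pos by (auto intro!: mult_mono prod_list_nonneg ip_self_nonneg)
    moreover have "((C2 * C\<^sup>2) * real (n + 1) ^ (2 * K + D)) * (B * real (n + 1) ^ (length vs * (2 * K + D)))
        = (C2 * C\<^sup>2 * B) * real (n + 1) ^ (length (v # vs) * (2 * K + D))" for n
      by (simp only: length_Cons mult_Suc power_add mult_ac)
    ultimately have "\<forall>n\<ge>1. (\<Prod>v\<leftarrow>v # vs. ip (wball p n) v v)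
        \<le> (C2 * C\<^sup>2 * B) * real (n + 1) ^ (length (v # vs) * (2 * K + D))"
      by (simp only:) blast
    moreover have "C2 * C\<^sup>2 * B \<ge> 0" using B(1) C2_pos by simp
    ultimately show ?case by blast
  qed
  then obtain B where "B \<ge> 0"
    "\<And>n. n \<ge> 1 \<Longrightarrow> (\<Prod>v\<leftarrow>vs. ip (wball p n) v v) \<le> B * real (n + 1) ^ (length vs * (2 * K + D))"
    by blast
  then show ?thesis using order_trans[OF gram_le_prod] by blast
qed

text \<open>A large ball contains the group elements of a finite determining set; at its other
  points harmonic functions vanish by definition.\<close>

lemma exists_determining_radius:
  assumes p: "p \<in> carrier G" and vs: "\<And>v. v \<in> set vs \<Longrightarrow> harmonic v"
  shows "\<exists>n0. \<forall>n\<ge>n0. \<forall>u\<in>fs.span (set vs). (\<forall>x\<in>wball p n. u x = 0) \<longrightarrow> u = 0"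
proof -
  obtain F where F: "finite F" "\<And>u. u \<in> fs.span (set vs) \<Longrightarrow> (\<forall>x\<in>F. u x = 0) \<Longrightarrow> u = 0"
    using exists_determining_set[of vs] by blast
  define n0 where "n0 = Max (insert 0 (dst p ` F))"
  have "u = 0" if "n \<ge> n0" "u \<in> fs.span (set vs)" "\<forall>x\<in>wball p n. u x = 0" for n u
  proof (rule F(2)[OF that(2)], rule ballI)
    fix x assume "x \<in> F"
    then have "dst p x \<le> n" using F(1) that(1) Max_ge[of "insert 0 (dst p ` F)" "dst p x"] by (auto simp: n0_def)
    moreover have "harmonic u" using harmonic_span vs that(2) by blast
    ultimately show "u x = 0" using that(3) p by (cases "x \<in> carrier G") (auto simp: mem_wball harmonic_def)
  qed
  then show ?thesis by blast
qed

text \<open>The doubling bound limits the total contraction over the \<open>K\<close> steps. The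
  rate \<open>1 / 4 ^ (D + 3)\<close> is tuned so that the exponents add up to at most half of
  \<open>q * K\<close>; the other half must be paid for by Whitney balls.\<close>

lemma length_le_of_polynomial_growth:
  assumes p: "p \<in> carrier G" and D: "D \<ge> 2" and K: "K \<ge> 1" and m: "m \<ge> 12"
    and \<eta>: "512 * (C2 * 2 ^ D / C1) * (C2 * 7 ^ D / C1) * real (card S) / (real m)\<^sup>2 \<le> 1 / 4 ^ (D + 3)"
    and vs: "distinct vs" "fs.independent (set vs)" "\<And>v. v \<in> set vs \<Longrightarrow> harmonic v"
    and bd: "\<And>v. v \<in> set vs \<Longrightarrow> \<exists>C. \<forall>x\<in>carrier G. \<bar>v x\<bar> \<le> C * (real (dst p x) + 1) ^ K"
  shows "real (length vs) \<le> 16 * (C2 / C1) * real (2 * m) ^ D * real K ^ (D - 1)"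
proof (cases "vs = []")
  case True
  then show ?thesis using C1_pos C2_pos by simp
next
  case False
  define q where "q = length vs"
  have q: "q \<ge> 1" using False by (simp add: q_def Suc_le_eq)
  define e where "e = q * (2 * K + D)"
  define g where "g = (\<lambda>n. gram (wball p n) vs)"
  obtain n0 where n0: "\<And>n u. n \<ge> n0 \<Longrightarrow> u \<in> fs.span (set vs) \<Longrightarrow> (\<forall>x\<in>wball p n. u x = 0) \<Longrightarrow> u = 0"
    using exists_determining_radius[OF p vs(3)] by blast
  have gpos: "g n > 0" if "n \<ge> n0" for n
    unfolding g_def using n0[OF that] by (intro gram_pos finite_wball p vs(1,2)) blast
  obtain B where B: "\<And>n. n \<ge> 1 \<Longrightarrow> g n \<le> B * real (n + 1) ^ e"
    using gram_le_poly[OF p bd] unfolding g_def e_def q_def by metis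
  \<comment> \<open>A multiple of \<open>K * m\<close>, so that every scale
    \<open>2 ^ i * N0\<close> splits into \<open>K\<close> steps of length \<open>m * r\<close> with
    \<open>r\<close> a natural number; \<open>Suc n0\<close> keeps the Gram determinant positive
    there.\<close>
  define N0 where "N0 = K * (m * Suc n0)"
  have N0: "N0 \<ge> n0" "N0 \<ge> 1"
  proof -
    have "1 * (1 * Suc n0) \<le> K * (m * Suc n0)" using K m by (intro mult_le_mono) auto
    then have "Suc n0 \<le> N0" by (simp only: N0_def mult_1)
    then show "N0 \<ge> n0" "N0 \<ge> 1" by auto
  qed
  obtain i where i: "g (2 * (2 ^ i * N0)) \<le> 2 ^ Suc e * g (2 ^ i * N0)"
    using exists_doubling_scale[OF gpos[OF N0(1)] N0(2) B] by blast
  define r where "r = 2 ^ i * Suc n0"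
  define M where "M = m * r"
  have r: "r \<ge> 1" by (simp add: r_def Suc_le_eq)
  have N: "2 ^ i * N0 = K * M" by (simp only: N0_def M_def r_def mult_ac)
  have KM: "K * M \<ge> n0"
  proof -
    have "1 * N0 \<le> 2 ^ i * N0" by (intro mult_right_mono) auto
    then show ?thesis using N0 N by linarith
  qed
  have gKM: "g (K * M + K * M) \<le> 2 ^ Suc e * g (K * M)"
    using i unfolding N by (simp only: mult_2)
  have "\<forall>j. \<exists>Y. whitney p (K * M + Suc j * M) m r Y"
    using whitney_exists[OF p] by blast
  then obtain Y where Y: "\<And>j. whitney p (K * M + Suc j * M) m r (Y j)"
    using choice by meson
  let ?N = "\<lambda>j. \<Sum>s<K * M + Suc j * M. card (Y j s)"
  have M0: "M > 0" using m r by (simp add: M_def)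
  have "\<exists>n. q \<le> n + ?N j \<and> g (K * M + j * M) \<le> (1 / 4 ^ (D + 3)) ^ n * g (K * M + Suc j * M)" for j
  proof -
    have "1 * M \<le> K * M" using K by (intro mult_right_mono) auto
    then have "m * r < K * M + Suc j * M" using M0 by (simp add: M_def[symmetric])
    from gram_step[OF p m r this Y vs(3) \<eta>]
    show ?thesis by (simp add: q_def g_def M_def[symmetric])
  qed
  then obtain n where n: "\<And>j. q \<le> n j + ?N j"
      "\<And>j. g (K * M + j * M) \<le> (1 / 4 ^ (D + 3)) ^ n j * g (K * M + Suc j * M)"
    by metis
  have tele: "g (K * M) \<le> (1 / 4 ^ (D + 3)) ^ (\<Sum>j<k. n j) * g (K * M + k * M)" for k
  proof (induction k)
    case (Suc k)
    have "(1 / 4 ^ (D + 3)) ^ (\<Sum>j<k. n j) * g (K * M + k * M)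
      \<le> (1 / 4 ^ (D + 3)) ^ (\<Sum>j<k. n j) * ((1 / 4 ^ (D + 3)) ^ n k * g (K * M + Suc k * M))"
      by (intro mult_left_mono n(2)) auto
    also have "\<dots> = (1 / 4 ^ (D + 3)) ^ (\<Sum>j<Suc k. n j) * g (K * M + Suc k * M)"
      by (simp only: sum.lessThan_Suc power_add mult.assoc)
    finally show ?case using Suc by linarith
  qed simp
  define \<Sigma> where "\<Sigma> = (\<Sum>j<K. n j)"
  have "g (K * M) \<le> (1 / 4 ^ (D + 3)) ^ \<Sigma> * g (K * M + K * M)"
    using tele[of K] by (simp add: \<Sigma>_def)
  also have "\<dots> \<le> (1 / 4 ^ (D + 3)) ^ \<Sigma> * (2 ^ Suc e * g (K * M))"
    by (intro mult_left_mono gKM) auto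
  finally have "1 * g (K * M) \<le> ((1 / 4 ^ (D + 3)) ^ \<Sigma> * 2 ^ Suc e) * g (K * M)" by simp
  then have "1 \<le> (1 / 4 ^ (D + 3)) ^ \<Sigma> * (2::real) ^ Suc e"
    by (rule mult_right_le_imp_le) (rule gpos[OF KM])
  then have "(4 ^ (D + 3)) ^ \<Sigma> \<le> (2::real) ^ Suc e"
    by (simp add: power_one_over field_simps del: power_Suc)
  moreover have "((4::real) ^ (D + 3)) ^ \<Sigma> = 2 ^ (2 * ((D + 3) * \<Sigma>))"
    by (simp add: power_mult[of 2 2, simplified] power_mult[symmetric] del: power_add)
  ultimately have "2 * ((D + 3) * \<Sigma>) \<le> Suc e"
    by (simp del: power_Suc)
  also have "\<dots> \<le> q * (2 * K + D + 1)" using q by (simp add: e_def)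
  \<comment> \<open>\<open>K \<ge> 1\<close> absorbs the additive terms and produces the same factor
    \<open>D + 3\<close> as in the rate.\<close>
  also have "\<dots> \<le> q * ((D + 3) * K)"
  proof (rule mult_left_mono)
    have "(D + 1) * 1 \<le> (D + 1) * K" using K by (intro mult_left_mono) auto
    then show "2 * K + D + 1 \<le> (D + 3) * K" by (simp add: algebra_simps)
  qed simp
  finally have "(D + 3) * (2 * \<Sigma>) \<le> (D + 3) * (q * K)" by (simp only: mult_ac)
  then have small: "2 * \<Sigma> \<le> q * K" by (simp only: mult_le_cancel1)
  have "K * q = (\<Sum>j<K. q)" by simp
  also have "\<dots> \<le> (\<Sum>j<K. n j + ?N j)" using n(1) by (intro sum_mono)
  also have "\<dots> = \<Sigma> + (\<Sum>j<K. ?N j)" by (simp only: sum.distrib \<Sigma>_def)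
  finally have "K * q \<le> 2 * (\<Sum>j<K. ?N j)" using small mult.commute[of q K] by linarith
  then have "real (K * q) \<le> real (2 * (\<Sum>j<K. ?N j))" by (simp only: of_nat_le_iff)
  also have "\<dots> = 2 * (\<Sum>j<K. \<Sum>s<K * M + Suc j * M. real (card (Y j s)))" by simp
  also have "\<dots> \<le> 2 * (8 * (C2 / C1) * real (2 * m) ^ D * real K ^ D)"
    using Y by (intro mult_left_mono sum_whitney_card_le[OF p m r D K]) (auto simp: M_def)
  \<comment> \<open>One power of \<open>K\<close> is split off and cancelled, which yields the
    exponent \<open>D - 1\<close>.\<close>
  also have "real K ^ D = real K * real K ^ (D - 1)"
    using D by (simp flip: power_Suc)
  finally have "real K * real q \<le> real K * (16 * (C2 / C1) * real (2 * m) ^ D * real K ^ (D - 1))"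
    by (simp add: mult_ac)
  then show ?thesis
    unfolding q_def by (rule mult_left_le_imp_le) (use K in simp)
qed

section \<open>The case \<open>D \<le> 1\<close>\<close>

text \<open>If all large spheres had at least \<open>C2 + 1\<close> points, the volume would grow
  with slope \<open>C2 + 1\<close>, against the upper bound with slope \<open>C2\<close>.\<close>

lemma exists_small_sphere:
  assumes p: "p \<in> carrier G" and D: "D \<le> 1"
  shows "\<exists>n\<ge>n0. real (card {x \<in> carrier G. dst p x = Suc n}) < C2 + 1"
proof (rule ccontr)
  assume "\<not> ?thesis"
  then have big: "real (card {x \<in> carrier G. dst p x = Suc n}) \<ge> C2 + 1" if "n \<ge> n0" for n
    using that by (auto simp: not_less)
  have step: "growth G S (Suc n) = growth G S n + card {x \<in> carrier G. dst p x = Suc n}" for n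
  proof -
    have "wball p (Suc n) = wball p n \<union> {x \<in> carrier G. dst p x = Suc n}"
      using p by (auto simp: mem_wball)
    moreover have "finite {x \<in> carrier G. dst p x = Suc n}"
      by (rule finite_subset[OF _ finite_wball[OF p, of "Suc n"]]) (auto simp: mem_wball p)
    ultimately have "card (wball p (Suc n)) = card (wball p n) + card {x \<in> carrier G. dst p x = Suc n}"
      using p finite_wball[OF p] by (simp add: card_Un_disjoint mem_wball disjoint_iff)
    then show ?thesis by (simp add: card_wball[OF p])
  qed
  have low: "real k * (C2 + 1) \<le> real (growth G S (n0 + k))" for k
  proof (induction k)
    case (Suc k)
    then show ?case using big[of "n0 + k"] by (simp add: step algebra_simps)
  qed simp
  have "real k \<le> C2 * real n0" if "k \<ge> 1" for k
  proof -
    have "real k * (C2 + 1) \<le> C2 * real (n0 + k) ^ D"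
      using low[of k] growth_upper[of "n0 + k"] that by linarith
    also have "\<dots> \<le> C2 * real (n0 + k) ^ 1"
      using D that C2_pos by (intro mult_left_mono power_increasing) auto
    finally show ?thesis by (simp add: algebra_simps)
  qed
  from this[of "Suc (nat \<lceil>C2 * real n0\<rceil>)"] show False by linarith
qed

text \<open>Otherwise the evaluations at \<open>p\<close> and on a small sphere are fewer than the
  functions, so \<open>ws\<close> is nonempty, and its span vanishes on the whole ball by
  \<open>harmonic_vanishes_on_ball\<close>. This contradicts the positivity of the Gram
  determinant.\<close>

lemma length_le_of_linear_growth:
  assumes p: "p \<in> carrier G" and D: "D \<le> 1"
    and vs: "distinct vs" "fs.independent (set vs)" "\<And>v. v \<in> set vs \<Longrightarrow> harmonic v"
  shows "real (length vs) \<le> C2 + 2"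
proof (rule ccontr)
  assume "\<not> ?thesis"
  then have large: "real (length vs) > C2 + 2" by simp
  obtain n0 where n0: "\<And>n u. n \<ge> n0 \<Longrightarrow> u \<in> fs.span (set vs) \<Longrightarrow> (\<forall>x\<in>wball p n. u x = 0) \<Longrightarrow> u = 0"
    using exists_determining_radius[OF p vs(3)] by blast
  obtain n where n: "n \<ge> n0" "real (card {x \<in> carrier G. dst p x = Suc n}) < C2 + 1"
    using exists_small_sphere[OF p D] by blast
  let ?A = "{x \<in> carrier G. dst p x = Suc n}"
  have "finite ?A"
    by (rule finite_subset[OF _ finite_wball[OF p, of "Suc n"]]) (auto simp: mem_wball p)
  then obtain xs where xs: "set xs = ?A" "distinct xs" using finite_distinct_list by blast
  define l :: "'a \<Rightarrow> ('a \<Rightarrow> real) \<Rightarrow> real" where "l = (\<lambda>x u. u x)"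
  have "\<exists>us ws. length us \<le> length (map l (p # xs)) \<and> length us + length ws = length vs
    \<and> set (us @ ws) \<subseteq> fs.span (set vs)
    \<and> (\<forall>l\<in>set (map l (p # xs)). \<forall>w\<in>set ws. l w = 0) \<and> (\<forall>F. finite F \<longrightarrow> gram F (us @ ws) = gram F vs)"
    by (rule gram_adapted_list) (auto simp: l_def fscale_apply)
  then obtain us ws where us: "length us \<le> Suc (length xs)" "length us + length ws = length vs"
    "set (us @ ws) \<subseteq> fs.span (set vs)" "\<And>x w. x \<in> insert p ?A \<Longrightarrow> w \<in> set ws \<Longrightarrow> w x = 0"
    "\<And>F. finite F \<Longrightarrow> gram F (us @ ws) = gram F vs"
    unfolding xs(1)[symmetric] l_def by fastforce
  have len: "length xs = card ?A" using xs distinct_card by metis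
  have "length ws > 0" using us(1,2) n(2) large unfolding len by linarith
  let ?B = "wball p (Suc n)"
  \<comment> \<open>The ball is compared with itself; any positive factor below 1 would do, since
    the norms are zero.\<close>
  have "gram ?B (us @ ws) \<le> (1 / 2) ^ length ws * gram ?B (us @ ws)"
  proof (rule gram_contract)
    fix u assume u: "u \<in> fs.span (set ws)"
    have "set ws \<subseteq> fs.span (set vs)" using us(3) by auto
    then have "u \<in> fs.span (set vs)" using fs.span_minimal[OF _ fs.subspace_span] u by blast
    then have h: "harmonic u" using harmonic_span vs by blast
    have "u x = 0" if "x \<in> insert p ?A" for x
    proof -
      have "fs.subspace {u. u x = 0}"
        by (rule fs.subspaceI) (auto simp: fscale_apply)
      moreover have "set ws \<subseteq> {u. u x = 0}" using us(4) that by blast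
      ultimately show ?thesis using fs.span_minimal u by blast
    qed
    then have "u x = 0" if "x \<in> ?B" for x
      using harmonic_vanishes_on_ball[OF p h] that by blast
    then show "ip ?B u u \<le> 1 / 2 * ip ?B u u" by (simp add: ip_def)
  qed (use finite_wball p in auto)
  moreover have pos: "gram ?B (us @ ws) > 0"
  proof -
    have "gram ?B vs > 0" using n0[of "Suc n"] n(1) by (intro gram_pos finite_wball p vs(1,2)) auto
    then show ?thesis using us(5) finite_wball[OF p] by simp
  qed
  moreover have "(1 / 2 :: real) ^ length ws < 1"
    using \<open>length ws > 0\<close> by (simp add: power_one_over)
  ultimately show False
    using mult_strict_right_mono[of "(1 / 2) ^ length ws" 1 "gram ?B (us @ ws)"] by linarith
qed

section \<open>Conclusion for all real degrees\<close>

text \<open>The base \<open>real (dst p x) + 1\<close> is at least 1, so the real exponent may be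
  raised to an integer; the absolute value of \<open>C\<close> makes the bound monotone.\<close>

lemma harm_polyD:
  assumes "u \<in> harm_poly G S p d" "d \<le> real K"
  shows "harmonic u" "\<exists>C. \<forall>x\<in>carrier G. \<bar>u x\<bar> \<le> C * (real (dst p x) + 1) ^ K"
proof -
  show "harmonic u"
    using assms(1) laplacian_eq by (simp add: harm_poly_def harmonic_def)
  obtain C where C: "\<And>x. x \<in> carrier G \<Longrightarrow> \<bar>u x\<bar> \<le> C * (real (dst p x) + 1) powr d"
    using assms(1) by (auto simp: harm_poly_def)
  have "\<bar>u x\<bar> \<le> \<bar>C\<bar> * (real (dst p x) + 1) ^ K" if "x \<in> carrier G" for x
  proof -
    have "C * (real (dst p x) + 1) powr d \<le> \<bar>C\<bar> * (real (dst p x) + 1) powr d"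
      by (intro mult_right_mono) auto
    then have "\<bar>u x\<bar> \<le> \<bar>C\<bar> * (real (dst p x) + 1) powr d"
      using C[OF that] by linarith
    also have "\<dots> \<le> \<bar>C\<bar> * (real (dst p x) + 1) powr real K"
      using assms(2) by (intro mult_left_mono powr_mono) auto
    also have "(real (dst p x) + 1) powr real K = (real (dst p x) + 1) ^ K"
      by (rule powr_realpow) simp
    finally show ?thesis .
  qed
  then show "\<exists>C. \<forall>x\<in>carrier G. \<bar>u x\<bar> \<le> C * (real (dst p x) + 1) ^ K" by blast
qed

lemma harm_poly_dim_le:
  assumes p: "p \<in> carrier G"
  shows "\<exists>C. \<forall>d\<ge>1. fun_finite_dim (harm_poly G S p d) \<and> real (fun_dim (harm_poly G S p d)) \<le> C * d ^ (D - 1)"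
proof (cases "D \<ge> 2")
  case False
  \<comment> \<open>Truncated subtraction gives the exponent 0 for both \<open>D = 0\<close> and
    \<open>D = 1\<close>, so a constant bound is what is asked for.\<close>
  have "fun_finite_dim (harm_poly G S p d) \<and> real (fun_dim (harm_poly G S p d)) \<le> (C2 + 2) * d ^ (D - 1)"
    if "d \<ge> 1" for d
  proof (rule fun_dim_le)
    fix vs assume vs: "distinct vs" "set vs \<subseteq> harm_poly G S p d" "fs.independent (set vs)"
    have "harmonic v" if "v \<in> set vs" for v
      using harm_polyD(1)[of v p d "nat \<lceil>d\<rceil>"] vs that by (auto simp: real_nat_ceiling_ge)
    then have "real (length vs) \<le> C2 + 2"
      using False vs by (intro length_le_of_linear_growth p) auto
    then show "real (length vs) \<le> (C2 + 2) * d ^ (D - 1)" using False by simp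
  qed
  then show ?thesis by blast
next
  case True
  define A where "A = 512 * (C2 * 2 ^ D / C1) * (C2 * 7 ^ D / C1) * real (card S)"
  obtain k :: nat where k: "A * 4 ^ (D + 3) \<le> real k" using real_arch_simple by blast
  \<comment> \<open>Large enough for the contraction rate, and independent of
    \<open>d\<close>.\<close>
  define m where "m = k + 12"
  have m: "m \<ge> 12" by (simp add: m_def)
  have "A * 4 ^ (D + 3) \<le> (real m)\<^sup>2"
  proof -
    have "real m * 1 \<le> real m * real m" using m by (intro mult_left_mono) auto
    moreover have "real k \<le> real m" by (simp add: m_def)
    ultimately show ?thesis using k unfolding power2_eq_square by linarith
  qed
  then have \<eta>: "A / (real m)\<^sup>2 \<le> 1 / 4 ^ (D + 3)"
    using m by (simp add: field_simps)
  define C where "C = 16 * (C2 / C1) * real (2 * m) ^ D * 2 ^ (D - 1)"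
  have "fun_finite_dim (harm_poly G S p d) \<and> real (fun_dim (harm_poly G S p d)) \<le> C * d ^ (D - 1)"
    if d: "d \<ge> 1" for d
  proof (rule fun_dim_le)
    fix vs assume vs: "distinct vs" "set vs \<subseteq> harm_poly G S p d" "fs.independent (set vs)"
    \<comment> \<open>For \<open>d \<ge> 1\<close>, rounding up at most doubles \<open>d\<close>;
      this costs the factor \<open>2 ^ (D - 1)\<close> in \<open>C\<close>.\<close>
    define K where "K = nat \<lceil>d\<rceil>"
    have K: "K \<ge> 1" "d \<le> real K" "real K \<le> 2 * d" using d unfolding K_def by linarith+
    have "real (length vs) \<le> 16 * (C2 / C1) * real (2 * m) ^ D * real K ^ (D - 1)"
      using vs harm_polyD K(2) \<eta>
      by (intro length_le_of_polynomial_growth[OF p True K(1) m]) (auto simp: A_def subset_iff)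
    also have "\<dots> \<le> 16 * (C2 / C1) * real (2 * m) ^ D * (2 * d) ^ (D - 1)"
      using K C1_pos C2_pos by (intro mult_left_mono power_mono) auto
    also have "\<dots> = C * d ^ (D - 1)" by (simp add: C_def power_mult_distrib)
    finally show "real (length vs) \<le> C * d ^ (D - 1)" .
  qed
  then show ?thesis by blast
qed

end

theorem theorem1p1:
  fixes G (structure) and S :: "'a set" and p :: 'a and D :: nat
  assumes "group G"
    and "finite S" and "S \<subseteq> carrier G"
    and "\<forall>s\<in>S. inv\<^bsub>G\<^esub> s \<in> S"
    and "generate G S = carrier G"
    and "p \<in> carrier G"
    and "\<exists>C A. C > 0 \<and> A > 0 \<and> (\<forall>n\<ge>1. real (growth G S n) \<le> C * real n powr A)"
    and "\<exists>C1 C2. C1 > 0 \<and> C2 > 0 \<and>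
           (\<forall>n\<ge>1. C1 * real n ^ D \<le> real (growth G S n) \<and> real (growth G S n) \<le> C2 * real n ^ D)"
  shows "\<exists>C. \<forall>d::real. d \<ge> 1 \<longrightarrow>
           fun_finite_dim (harm_poly G S p d) \<and>
           real (fun_dim (harm_poly G S p d)) \<le> C * d ^ (D - 1)"
proof -
  obtain C1 C2 where "C1 > 0" "C2 > 0"
    "\<And>n. n \<ge> 1 \<Longrightarrow> C1 * real n ^ D \<le> real (growth G S n)"
    "\<And>n. n \<ge> 1 \<Longrightarrow> real (growth G S n) \<le> C2 * real n ^ D"
    using assms(8) by blast
  then interpret poly_cayley G S D C1 C2
    using assms by (intro poly_cayley.intro cayley.intro poly_cayley_axioms.intro cayley_axioms.intro) auto
  show ?thesis using harm_poly_dim_le[OF assms(6)] .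
qed

end
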